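(* For every integer $n\geqslant 10$, there are no irreducible complex representations of the braid group $B_n$ on $n$ strings of dimension $n+1$; that is, there is no irreducible representation $\rho: B_n\to GL_{n+1}(\mathbb{C})$.
   Context: $B_n$ is the braid group on $n$ strings, presented by the standard generators $\sigma_1,\dots,\sigma_{n-1}$ with relations $\sigma_i\sigma_j=\sigma_j\sigma_i$ for $|i-j|\geqslant 2$ and $\sigma_i\sigma_{i+1}\sigma_i=\sigma_{i+1}\sigma_i\sigma_{i+1}$ for $1\leqslant i\leqslant n-2$. *)

theory Defs
  imports Complex_Main "HOL-Algebra.Group" "Jordan_Normal_Form.VS_Connect"
begin

section \<open>Groups given by generators and relations\<close>

text \<open>A letter \<open>(x, True)\<close> stands for the generator \<open>x\<close>, and \<open>(x, False)\<close> for its formal inverse.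
  A relation \<open>u = v\<close> between words is given as the pair \<open>(u, v)\<close>.\<close>

type_synonym 'a gword = "('a \<times> bool) list"

abbreviation gwords :: "'a set \<Rightarrow> 'a gword set" where
  "gwords X \<equiv> lists (X \<times> UNIV)"

inductive pres_eq :: "'a set \<Rightarrow> ('a gword \<times> 'a gword) set \<Rightarrow> 'a gword \<Rightarrow> 'a gword \<Rightarrow> bool"
  for X R where
  rel: "(u, v) \<in> R \<Longrightarrow> u \<in> gwords X \<Longrightarrow> v \<in> gwords X \<Longrightarrow> pres_eq X R u v"
| cancel: "x \<in> X \<Longrightarrow> pres_eq X R [(x, e), (x, \<not> e)] []"
| append: "pres_eq X R u u' \<Longrightarrow> pres_eq X R v v' \<Longrightarrow> pres_eq X R (u @ v) (u' @ v')"
| refl: "u \<in> gwords X \<Longrightarrow> pres_eq X R u u"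
| sym: "pres_eq X R u v \<Longrightarrow> pres_eq X R v u"
| trans: "pres_eq X R u v \<Longrightarrow> pres_eq X R v w \<Longrightarrow> pres_eq X R u w"

definition pres_rel :: "'a set \<Rightarrow> ('a gword \<times> 'a gword) set \<Rightarrow> 'a gword rel" where
  "pres_rel X R = {(u, v). pres_eq X R u v}"

definition presented_group ::
  "'a set \<Rightarrow> ('a gword \<times> 'a gword) set \<Rightarrow> 'a gword set monoid" where
  "presented_group X R =
     \<lparr> carrier = gwords X // pres_rel X R,
       mult = (\<lambda>A B. \<Union>u\<in>A. \<Union>v\<in>B. pres_rel X R `` {u @ v}),
       one = pres_rel X R `` {[]} \<rparr>"

definition pres_gen :: "'a set \<Rightarrow> ('a gword \<times> 'a gword) set \<Rightarrow> 'a \<Rightarrow> 'a gword set" where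
  "pres_gen X R x = pres_rel X R `` {[(x, True)]}"

lemma pres_eq_words: "pres_eq X R u v \<Longrightarrow> u \<in> gwords X \<and> v \<in> gwords X"
  by (induction rule: pres_eq.induct) auto

lemma equiv_pres_rel: "equiv (gwords X) (pres_rel X R)"
proof (rule equivI)
  show "pres_rel X R \<subseteq> gwords X \<times> gwords X"
    using pres_eq_words[of X R] by (simp add: pres_rel_def subset_iff)
  show "refl_on (gwords X) (pres_rel X R)"
    by (simp add: refl_on_def pres_rel_def pres_eq.refl)
  show "sym (pres_rel X R)"
    by (auto simp: pres_rel_def intro: symI pres_eq.sym)
  show "trans (pres_rel X R)"
    by (auto simp: pres_rel_def intro: transI pres_eq.trans)
qed

lemma pres_class_eq_iff:
  assumes "u \<in> gwords X" "v \<in> gwords X"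
  shows "pres_rel X R `` {u} = pres_rel X R `` {v} \<longleftrightarrow> pres_eq X R u v"
  using eq_equiv_class_iff[OF equiv_pres_rel assms] by (simp add: pres_rel_def)

lemma presented_group_carrier_cases:
  assumes "A \<in> carrier (presented_group X R)"
  obtains u where "u \<in> gwords X" "A = pres_rel X R `` {u}"
  using assms unfolding presented_group_def by (auto elim!: quotientE)

lemma presented_group_class_closed:
  "u \<in> gwords X \<Longrightarrow> pres_rel X R `` {u} \<in> carrier (presented_group X R)"
  by (simp add: presented_group_def quotientI)

lemma presented_group_mult_class:
  assumes u: "u \<in> gwords X" and v: "v \<in> gwords X"
  shows "pres_rel X R `` {u} \<otimes>\<^bsub>presented_group X R\<^esub> pres_rel X R `` {v} = pres_rel X R `` {u @ v}"
proof -
  have uu: "pres_eq X R u u" and vv: "pres_eq X R v v"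
    using u v by (auto intro: pres_eq.refl)
  have "w \<in> pres_rel X R `` {u @ v}"
    if "pres_eq X R u u'" "pres_eq X R v v'" "pres_eq X R (u' @ v') w" for u' v' w
    using pres_eq.trans[OF pres_eq.append[OF that(1,2)] that(3)] by (simp add: pres_rel_def)
  with uu vv show ?thesis
    by (auto simp: presented_group_def pres_rel_def)
qed

lemma presented_group_one: "\<one>\<^bsub>presented_group X R\<^esub> = pres_rel X R `` {[]}"
  by (simp add: presented_group_def)

lemma gwords_inverse: "u \<in> gwords X \<Longrightarrow> rev (map (map_prod id Not) u) \<in> gwords X"
  by (induction u) auto

lemma pres_eq_inverse_word:
  "u \<in> gwords X \<Longrightarrow> pres_eq X R (rev (map (map_prod id Not) u) @ u) []"
proof (induction u)
  case Nil
  then show ?case by (auto intro: pres_eq.refl)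
next
  case (Cons a u)
  obtain x e where a: "a = (x, e)" by (cases a)
  let ?w = "rev (map (map_prod id Not) u)"
  have x: "x \<in> X" and u: "u \<in> gwords X"
    using Cons.prems a by auto
  have w: "?w \<in> gwords X" using u by (rule gwords_inverse)
  have 1: "pres_eq X R [(x, \<not> e), (x, e)] []"
    using pres_eq.cancel[OF x, where e = "\<not> e"] by simp
  have "pres_eq X R (?w @ ([(x, \<not> e), (x, e)] @ u)) (?w @ ([] @ u))"
    by (intro pres_eq.append 1 pres_eq.refl u w)
  then have "pres_eq X R (?w @ ([(x, \<not> e), (x, e)] @ u)) (?w @ u)"
    by (simp only: append_Nil)
  from pres_eq.trans[OF this Cons.IH[OF u]]
  have "pres_eq X R (?w @ ([(x, \<not> e), (x, e)] @ u)) []" .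
  then show ?case by (simp add: a id_def)
qed

theorem group_presented_group: "group (presented_group X R)"
proof (rule groupI)
  fix A B assume "A \<in> carrier (presented_group X R)" "B \<in> carrier (presented_group X R)"
  then show "A \<otimes>\<^bsub>presented_group X R\<^esub> B \<in> carrier (presented_group X R)"
    by (elim presented_group_carrier_cases)
      (simp add: presented_group_mult_class presented_group_class_closed)
next
  fix A B C
  assume "A \<in> carrier (presented_group X R)" "B \<in> carrier (presented_group X R)"
    "C \<in> carrier (presented_group X R)"
  then show "A \<otimes>\<^bsub>presented_group X R\<^esub> B \<otimes>\<^bsub>presented_group X R\<^esub> C =
      A \<otimes>\<^bsub>presented_group X R\<^esub> (B \<otimes>\<^bsub>presented_group X R\<^esub> C)"
    by (elim presented_group_carrier_cases)
      (simp add: presented_group_mult_class)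
next
  fix A assume "A \<in> carrier (presented_group X R)"
  then obtain u where u: "u \<in> gwords X" and A: "A = pres_rel X R `` {u}"
    by (rule presented_group_carrier_cases)
  show "\<one>\<^bsub>presented_group X R\<^esub> \<otimes>\<^bsub>presented_group X R\<^esub> A = A"
    using presented_group_mult_class[of "[]" X u R] u A by (simp add: presented_group_one)
  let ?v = "rev (map (map_prod id Not) u)"
  have v: "?v \<in> gwords X" using u by (rule gwords_inverse)
  have "pres_rel X R `` {?v} \<otimes>\<^bsub>presented_group X R\<^esub> A = \<one>\<^bsub>presented_group X R\<^esub>"
    using u v pres_eq_inverse_word[OF u, of R]
    by (simp add: A presented_group_mult_class presented_group_one pres_class_eq_iff)
  then show "\<exists>B\<in>carrier (presented_group X R).
      B \<otimes>\<^bsub>presented_group X R\<^esub> A = \<one>\<^bsub>presented_group X R\<^esub>"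
    using presented_group_class_closed[OF v] by blast
qed (simp add: presented_group_one presented_group_class_closed)

text \<open>The universal property of the presentation.\<close>

definition word_eval :: "('b, 'c) monoid_scheme \<Rightarrow> ('a \<Rightarrow> 'b) \<Rightarrow> 'a gword \<Rightarrow> 'b" where
  "word_eval H f w =
     foldr (\<lambda>(x, e) h. (if e then f x else inv\<^bsub>H\<^esub> f x) \<otimes>\<^bsub>H\<^esub> h) w \<one>\<^bsub>H\<^esub>"

lemma word_eval_closed:
  assumes "group H" "f \<in> X \<rightarrow> carrier H" "w \<in> gwords X"
  shows "word_eval H f w \<in> carrier H"
proof -
  interpret group H by fact
  show ?thesis using assms(3)
    by (induction w) (use assms(2) in \<open>auto simp: word_eval_def Pi_iff\<close>)
qed

lemma word_eval_append:
  assumes "group H" "f \<in> X \<rightarrow> carrier H" "u \<in> gwords X" "v \<in> gwords X"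
  shows "word_eval H f (u @ v) = word_eval H f u \<otimes>\<^bsub>H\<^esub> word_eval H f v"
proof -
  interpret group H by fact
  show ?thesis using assms(3)
  proof (induction u)
    case Nil
    then show ?case using word_eval_closed[OF assms(1,2,4)] by (simp add: word_eval_def)
  next
    case (Cons a u)
    then show ?case
      using word_eval_closed[OF assms(1,2,4)] word_eval_closed[OF assms(1,2), of u] assms(2)
      by (cases a) (auto simp: word_eval_def m_assoc Pi_iff)
  qed
qed

theorem presented_group_universal:
  assumes H: "group H" and f: "f \<in> X \<rightarrow> carrier H"
    and R: "\<And>u v. (u, v) \<in> R \<Longrightarrow> u \<in> gwords X \<Longrightarrow> v \<in> gwords X \<Longrightarrow> word_eval H f u = word_eval H f v"
  shows "\<exists>h\<in>hom (presented_group X R) H. \<forall>x\<in>X. h (pres_gen X R x) = f x"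
proof -
  interpret group H by fact
  have eq: "word_eval H f u = word_eval H f v" if "pres_eq X R u v" for u v
    using that
  proof (induction rule: pres_eq.induct)
    case (cancel x e)
    then show ?case using f by (cases e) (auto simp: word_eval_def Pi_iff)
  next
    case (append u u' v v')
    then show ?case using pres_eq_words[OF append.hyps(1)] pres_eq_words[OF append.hyps(2)]
      by (simp add: word_eval_append[OF H f])
  qed (auto intro: R)
  define h where "h = (\<lambda>A. word_eval H f (SOME u. u \<in> A))"
  have h: "h (pres_rel X R `` {u}) = word_eval H f u" if u: "u \<in> gwords X" for u
  proof -
    have "u \<in> pres_rel X R `` {u}" using u by (auto simp: pres_rel_def intro: pres_eq.refl)
    then have "(SOME v. v \<in> pres_rel X R `` {u}) \<in> pres_rel X R `` {u}" by (rule someI)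
    then have "pres_eq X R u (SOME v. v \<in> pres_rel X R `` {u})" by (simp add: pres_rel_def)
    from eq[OF this] show ?thesis by (simp add: h_def)
  qed
  have "h \<in> hom (presented_group X R) H"
  proof (rule homI)
    fix A assume "A \<in> carrier (presented_group X R)"
    then show "h A \<in> carrier H"
      by (elim presented_group_carrier_cases) (simp add: h word_eval_closed[OF H f])
  next
    fix A B assume "A \<in> carrier (presented_group X R)" "B \<in> carrier (presented_group X R)"
    then show "h (A \<otimes>\<^bsub>presented_group X R\<^esub> B) = h A \<otimes>\<^bsub>H\<^esub> h B"
      by (elim presented_group_carrier_cases)
        (simp add: presented_group_mult_class h word_eval_append[OF H f])
  qed
  moreover have "h (pres_gen X R x) = f x" if "x \<in> X" for x
    unfolding pres_gen_def using that f by (subst h) (auto simp: word_eval_def Pi_iff)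
  ultimately show ?thesis by blast
qed

section \<open>Braid groups\<close>

definition braid_relations :: "nat \<Rightarrow> (nat gword \<times> nat gword) set" where
  "braid_relations n =
     {([(i, True), (j, True)], [(j, True), (i, True)]) | i j.
        i \<in> {1..n - 1} \<and> j \<in> {1..n - 1} \<and> \<bar>int i - int j\<bar> \<ge> 2} \<union>
     {([(i, True), (i + 1, True), (i, True)], [(i + 1, True), (i, True), (i + 1, True)]) | i.
        i \<in> {1..n - 2}}"

definition braid_group :: "nat \<Rightarrow> nat gword set monoid" where
  "braid_group n = presented_group {1..n - 1} (braid_relations n)"

section \<open>Irreducible complex matrix representations\<close>

definition GL :: "nat \<Rightarrow> complex mat monoid" where
  "GL m = units_of (ring_mat TYPE(complex) m ())"

definition complex_representation ::
  "('g, 'b) monoid_scheme \<Rightarrow> nat \<Rightarrow> ('g \<Rightarrow> complex mat) \<Rightarrow> bool" where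
  "complex_representation G m \<rho> \<longleftrightarrow> \<rho> \<in> hom G (GL m)"

definition invariant_subspace ::
  "('g, 'b) monoid_scheme \<Rightarrow> nat \<Rightarrow> ('g \<Rightarrow> complex mat) \<Rightarrow> complex vec set \<Rightarrow> bool" where
  "invariant_subspace G m \<rho> W \<longleftrightarrow>
     VectorSpace.subspace class_ring W (module_vec TYPE(complex) m) \<and>
     (\<forall>g\<in>carrier G. \<forall>w\<in>W. \<rho> g *\<^sub>v w \<in> W)"

definition irreducible_representation ::
  "('g, 'b) monoid_scheme \<Rightarrow> nat \<Rightarrow> ('g \<Rightarrow> complex mat) \<Rightarrow> bool" where
  "irreducible_representation G m \<rho> \<longleftrightarrow>
     complex_representation G m \<rho> \<and> m > 0 \<and>
     (\<forall>W. invariant_subspace G m \<rho> W \<longrightarrow> W = {0\<^sub>v m} \<or> W = carrier_vec m)"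

end

theory Submission
  imports Defs "HOL-Library.Function_Algebras" "HOL-Computational_Algebra.Fundamental_Theorem_Algebra"
begin

text \<open>
  Write \<open>S\<^sub>i\<close> for the operator of \<open>\<sigma>\<^sub>i\<close> on \<open>V\<close> and scale so that the chosen eigenvalue is \<open>1\<close>;
  put \<open>A\<^sub>i = S\<^sub>i - 1\<close>. Since \<open>\<sigma>\<^sub>1\<close> commutes with \<open>\<sigma>\<^sub>3, \<dots>, \<sigma>\<^sub>n\<^sub>-\<^sub>1\<close>, its eigenspaces are representations of
  \<open>B\<^sub>n\<^sub>-\<^sub>2\<close>, and all generators of \<open>B\<^sub>m\<close> (\<open>m \<ge> 5\<close>) act by the same operator in any representation of
  dimension at most \<open>m - 3\<close>. If all eigenspaces of \<open>S\<^sub>1\<close> had dimension at most \<open>5 \<le> (n - 2) - 3\<close>, then all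
  \<open>S\<^sub>i\<close> would coincide on \<open>V\<close>. So for some eigenvalue the image of \<open>A\<^sub>1\<close> has dimension at most \<open>n - 5\<close>,
  hence \<open>S\<^sub>3 = \<dots> = S\<^sub>n\<^sub>-\<^sub>1\<close> on it. It follows that \<open>A\<^sub>i A\<^sub>j V\<close> is one and the same invariant subspace for all
  \<open>i, j\<close> that are not adjacent, and so \<open>A\<^sub>i A\<^sub>j = 0\<close>. The braid relation says that the operator
  \<open>C\<^sub>i = A\<^sub>i A\<^sub>i\<^sub>+\<^sub>1 A\<^sub>i + A\<^sub>i\<^sup>2 + A\<^sub>i\<close> (called \<open>tri\<close>) is symmetric in \<open>i\<close> and \<open>i + 1\<close>. If \<open>C\<^sub>1 = 0\<close>, an eigenvector of \<open>A\<^sub>1\<close> in its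
  image spans, together with its translates \<open>A\<^sub>i \<cdots> A\<^sub>2 v\<close>, an invariant subspace of dimension at
  most \<open>n - 1\<close> (reduced Burau type). Otherwise an eigenvector of \<open>S\<^sub>2\<^sup>2\<close> in the image of \<open>C\<^sub>1\<close> generates
  an invariant subspace of dimension at most \<open>n\<close> (the type found by Tong, Yang and Ma).
\<close>

section \<open>Linear algebra over the complex numbers\<close>

locale complex_space = vector_space scale
  for scale :: "complex \<Rightarrow> 'a :: ab_group_add \<Rightarrow> 'a" (infixr \<open>*s\<close> 75)
begin

abbreviation lin :: "('a \<Rightarrow> 'a) \<Rightarrow> bool" where
  "lin \<equiv> Vector_Spaces.linear scale scale"

lemma linI:
  assumes "\<And>x y. f (x + y) = f x + f y" "\<And>c x. f (c *s x) = c *s f x"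
  shows "lin f"
  using assms by (simp add: Vector_Spaces.linear_iff vector_space_axioms)

lemma lin_add: "lin f \<Longrightarrow> f (x + y) = f x + f y"
  and lin_scale: "lin f \<Longrightarrow> f (c *s x) = c *s f x"
  by (simp_all add: Vector_Spaces.linear_iff)

lemma lin_module_hom: "lin f \<Longrightarrow> module_hom scale scale f"
  by (simp add: linear_iff_module_hom)

lemma lin_0: "lin f \<Longrightarrow> f 0 = 0"
  and lin_diff: "lin f \<Longrightarrow> f (x - y) = f x - f y"
  and lin_neg: "lin f \<Longrightarrow> f (- x) = - f x"
  by (simp_all add: module_hom.zero[OF lin_module_hom] module_hom.diff[OF lin_module_hom]
      module_hom.neg[OF lin_module_hom])

lemmas lin_simps = lin_add lin_scale lin_0 lin_diff lin_neg

lemma subspace_lin_image: "lin f \<Longrightarrow> subspace W \<Longrightarrow> subspace (f ` W)"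
  using module_hom.subspace_image[OF lin_module_hom] by blast

lemma lin_span_image: "lin f \<Longrightarrow> span (f ` B) = f ` span B"
  using module_hom.span_image[OF lin_module_hom] by blast

lemma lin_shift: "lin f \<Longrightarrow> lin (\<lambda>x. f x - c *s x)"
  by (rule linI) (simp_all add: lin_simps algebra_simps)

text \<open>An upper bound takes the place of the dimension itself, so that the ambient space may
  have infinite dimension and finiteness is part of every bound.\<close>

definition dim_le :: "'a set \<Rightarrow> nat \<Rightarrow> bool" where
  "dim_le W k \<longleftrightarrow> (\<exists>B. finite B \<and> card B \<le> k \<and> W \<subseteq> span B)"

lemma dim_le_subset: "dim_le W k \<Longrightarrow> U \<subseteq> W \<Longrightarrow> dim_le U k"
  unfolding dim_le_def by blast

lemma dim_le_mono: "dim_le W j \<Longrightarrow> j \<le> k \<Longrightarrow> dim_le W k"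
  unfolding dim_le_def using le_trans by blast

lemma dim_le_span: "finite B \<Longrightarrow> card B \<le> k \<Longrightarrow> dim_le (span B) k"
  unfolding dim_le_def by blast

lemma dim_le_0: "dim_le W 0 \<longleftrightarrow> W \<subseteq> {0}"
proof
  assume "W \<subseteq> {0}"
  then show "dim_le W 0" unfolding dim_le_def by (intro exI[of _ "{}"]) simp
qed (auto simp: dim_le_def)

lemma dim_le_image:
  assumes "lin f" "dim_le W k"
  shows "dim_le (f ` W) k"
proof -
  obtain B where B: "finite B" "card B \<le> k" "W \<subseteq> span B"
    using assms(2) unfolding dim_le_def by blast
  have "f ` W \<subseteq> span (f ` B)" using B(3) by (auto simp: lin_span_image[OF assms(1)])
  moreover have "card (f ` B) \<le> k" using card_image_le[OF B(1), of f] B(2) by simp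
  ultimately show ?thesis unfolding dim_le_def using B(1) by blast
qed

lemma dim_le_independent:
  assumes "dim_le W k" "independent B" "B \<subseteq> W"
  shows "finite B \<and> card B \<le> k"
  using assms independent_span_bound[of _ B] unfolding dim_le_def by (meson le_trans order_trans)

lemma subspace_basis:
  assumes "dim_le W k" "subspace W"
  obtains B where "B \<subseteq> W" "independent B" "span B = W" "finite B" "card B \<le> k"
proof -
  obtain B where B: "B \<subseteq> W" "independent B" "W \<subseteq> span B"
    using maximal_independent_subset[of W] by blast
  then have "span B = W" using assms(2) by (simp add: span_subspace)
  with B dim_le_independent[OF assms(1) B(2,1)] that show ?thesis by blast
qed

lemma not_dim_le_independent:
  assumes "\<not> dim_le W k"
  obtains B where "B \<subseteq> W" "independent B" "finite B" "card B = Suc k"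
proof -
  obtain B where B: "B \<subseteq> W" "independent B" "W \<subseteq> span B"
    using maximal_independent_subset[of W] by blast
  have "infinite B \<or> Suc k \<le> card B" using assms B(3) unfolding dim_le_def by force
  then obtain C where "C \<subseteq> B" "finite C" "card C = Suc k"
    by (metis infinite_arbitrarily_large obtain_subset_with_card_n)
  with B that show ?thesis by (meson independent_mono order_trans)
qed

text \<open>Rank and nullity as an inequality: extend \<open>Suc a\<close> independent kernel
  vectors to a basis of \<open>W\<close>; only the remaining basis vectors, at most
  \<open>d - Suc a\<close> of them, contribute to the image. The second conclusion says that this
  subtraction is not truncated.\<close>

lemma dim_le_image_kernel:
  assumes f: "lin f" and W: "dim_le W d" "subspace W"
    and K: "\<not> dim_le {x\<in>W. f x = 0} a"
  shows "dim_le (f ` W) (d - Suc a)" "Suc a \<le> d"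
proof -
  obtain B where B: "B \<subseteq> {x\<in>W. f x = 0}" "independent B" "finite B" "card B = Suc a"
    using not_dim_le_independent[OF K] .
  obtain C where C: "B \<subseteq> C" "C \<subseteq> W" "independent C" "W \<subseteq> span C"
    using maximal_independent_subset_extend[of B W] B by blast
  have fC: "finite C" "card C \<le> d" using dim_le_independent[OF W(1) C(3,2)] by auto
  then show "Suc a \<le> d" using card_mono[OF _ C(1)] B(4) by simp
  have "f ` W \<subseteq> span (f ` C)" using C(4) by (auto simp: lin_span_image[OF f])
  also have "\<dots> = span (insert 0 (f ` C))" by simp
  also have "\<dots> \<subseteq> span (insert 0 (f ` (C - B)))"
    by (rule span_mono) (use B(1) in auto)
  finally have "f ` W \<subseteq> span (f ` (C - B))" by simp
  moreover have "card (f ` (C - B)) \<le> d - Suc a"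
    using card_image_le[of "C - B" f] fC B(4) card_Diff_subset[OF B(3) C(1)] by simp
  moreover have "finite (f ` (C - B))" using fC(1) by simp
  ultimately show "dim_le (f ` W) (d - Suc a)" unfolding dim_le_def by blast
qed

text \<open>Dimension count: a vector of \<open>W\<close> outside the image, added to the image of a
  basis of \<open>W\<close>, would give too many independent vectors in \<open>W\<close>.\<close>

lemma inj_image_eq:
  assumes f: "lin f" "inj f" and W: "dim_le W k" "subspace W" and "f ` W \<subseteq> W"
  shows "f ` W = W"
proof (rule ccontr)
  assume "f ` W \<noteq> W"
  then obtain w where w: "w \<in> W" "w \<notin> f ` W" using assms(5) by blast
  obtain B where B: "B \<subseteq> W" "independent B" "span B = W" "finite B"
    using subspace_basis[OF W] .
  have ind: "independent (f ` B)"
    using B(2) f module_hom.independent_injective_image[OF lin_module_hom[OF f(1)]]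
    by (meson inj_on_subset subset_UNIV)
  have w': "w \<notin> span (f ` B)" using w(2) B(3) by (simp add: lin_span_image[OF f(1)])
  then have "independent (insert w (f ` B))" using ind by (rule independent_insertI)
  moreover have "insert w (f ` B) \<subseteq> span B" using B(1,3) w(1) assms(5) by auto
  ultimately have "card (insert w (f ` B)) \<le> card B"
    using independent_span_bound[OF B(4)] by blast
  moreover have "w \<notin> f ` B" using w' span_base by blast
  moreover have "card (f ` B) = card B" using f(2) by (simp add: card_image inj_on_subset)
  ultimately show False using B(4) by simp
qed

text \<open>If every vector were outside the span of the earlier ones, \<open>Suc k\<close>
  independent vectors would lie in \<open>W\<close>. The lemma is applied to the iterates of an
  operator, to chains and to unit sequences.\<close>

lemma dim_le_sequence:
  assumes "dim_le W k" "\<And>i. i \<le> k \<Longrightarrow> u i \<in> W"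
  shows "\<exists>N\<le>k. u N \<in> span (u ` {..<N})"
proof (rule ccontr)
  assume *: "\<not> ?thesis"
  have "independent (u ` {..<N}) \<and> card (u ` {..<N}) = N" if "N \<le> Suc k" for N
    using that
  proof (induction N)
    case (Suc N)
    then have N: "u N \<notin> span (u ` {..<N})" using * by auto
    have "u N \<notin> u ` {..<N}" using N by (rule contrapos_nn) (rule span_base)
    with Suc.IH Suc.prems independent_insertI[OF N] show ?case by (simp add: lessThan_Suc)
  qed (simp add: independent_empty)
  from this[of "Suc k"] have "independent (u ` {..<Suc k})" "card (u ` {..<Suc k}) = Suc k"
    by auto
  moreover have "u ` {..<Suc k} \<subseteq> W" using assms(2) by (auto simp: less_Suc_eq_le)
  ultimately show False using dim_le_independent[OF assms(1), of "u ` {..<Suc k}"] by linarith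
qed

section \<open>Polynomials in an operator, and the existence of eigenvectors\<close>

definition op_poly :: "('a \<Rightarrow> 'a) \<Rightarrow> complex poly \<Rightarrow> 'a \<Rightarrow> 'a" where
  "op_poly f p x = fold_coeffs (\<lambda>a y. a *s x + f y) p 0"

lemma op_poly_0 [simp]: "op_poly f 0 x = 0"
  by (simp add: op_poly_def)

lemma op_poly_pCons:
  assumes "lin f"
  shows "op_poly f (pCons a p) x = a *s x + f (op_poly f p x)"
  by (cases "a = 0 \<and> p = 0") (auto simp: op_poly_def lin_0[OF assms])

lemma op_poly_add: "lin f \<Longrightarrow> op_poly f (p + q) x = op_poly f p x + op_poly f q x"
proof (induction p arbitrary: q)
  case (pCons a p)
  obtain b r where q: "q = pCons b r" by (cases q)
  show ?case
    by (simp add: q op_poly_pCons[OF pCons.prems] pCons.IH[OF pCons.prems] lin_add[OF pCons.prems]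
        scale_left_distrib)
qed simp

lemma op_poly_smult: "lin f \<Longrightarrow> op_poly f (smult c p) x = c *s op_poly f p x"
  by (induction p) (simp_all add: op_poly_pCons lin_scale scale_right_distrib)

lemma op_poly_monom: "lin f \<Longrightarrow> op_poly f (monom 1 N) x = (f ^^ N) x"
  by (induction N) (simp_all add: monom_0 monom_Suc op_poly_pCons lin_0)

lemma op_poly_linear_factor:
  assumes "lin f"
  shows "op_poly f ([:- c, 1:] * p) x = f (op_poly f p x) - c *s op_poly f p x"
  using assms
  by (simp add: op_poly_add op_poly_pCons op_poly_smult scale_minus_left flip: smult_minus_left)

text \<open>A nonzero polynomial \<open>p\<close> of least degree with \<open>p(f) v = 0\<close> has
  a complex root \<open>c\<close>. Write \<open>p = (X - c) r\<close>: by minimality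
  \<open>r(f) v\<close> is nonzero, and \<open>f - c\<close> kills it.\<close>

lemma exists_eigenvector:
  assumes f: "lin f" and W: "dim_le W k" "subspace W" "f ` W \<subseteq> W" "\<not> W \<subseteq> {0}"
  shows "\<exists>c. \<exists>v\<in>W. v \<noteq> 0 \<and> f v = c *s v"
proof -
  obtain v where v: "v \<in> W" "v \<noteq> 0" using W(4) by blast
  have it: "(f ^^ i) v \<in> W" for i using v W(3) by (induction i) auto
  obtain N where N: "(f ^^ N) v \<in> span ((\<lambda>i. (f ^^ i) v) ` {..<N})"
    using dim_le_sequence[OF W(1), of "\<lambda>i. (f ^^ i) v"] it by blast
  \<comment> \<open>The vectors \<open>q(f) v\<close> with \<open>q\<close> of degree below
    \<open>N\<close>; stating the bound through coefficients also admits
    \<open>q = 0\<close>.\<close>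
  let ?P = "{op_poly f p v |p. \<forall>i\<ge>N. coeff p i = 0}"
  have "subspace ?P"
  proof (rule subspaceI)
    show "0 \<in> ?P" by (rule CollectI, rule exI[of _ 0]) simp
  next
    fix x y assume "x \<in> ?P" "y \<in> ?P"
    then obtain p q where "x = op_poly f p v" "y = op_poly f q v" "\<forall>i\<ge>N. coeff p i = 0"
      "\<forall>i\<ge>N. coeff q i = 0" by blast
    then show "x + y \<in> ?P" by (intro CollectI exI[of _ "p + q"]) (simp add: op_poly_add[OF f])
  next
    fix c x assume "x \<in> ?P"
    then obtain p where "x = op_poly f p v" "\<forall>i\<ge>N. coeff p i = 0" by blast
    then show "c *s x \<in> ?P" by (intro CollectI exI[of _ "smult c p"]) (simp add: op_poly_smult[OF f])
  qed
  moreover have "(\<lambda>i. (f ^^ i) v) ` {..<N} \<subseteq> ?P"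
  proof
    fix y assume "y \<in> (\<lambda>i. (f ^^ i) v) ` {..<N}"
    then obtain i where "i < N" "y = (f ^^ i) v" by blast
    then show "y \<in> ?P" by (intro CollectI exI[of _ "monom 1 i"]) (simp add: op_poly_monom[OF f])
  qed
  ultimately have "span ((\<lambda>i. (f ^^ i) v) ` {..<N}) \<subseteq> ?P" by (intro span_minimal)
  with N obtain q where q: "(f ^^ N) v = op_poly f q v" "coeff q N = 0" by auto
  define P where "P p \<longleftrightarrow> p \<noteq> 0 \<and> op_poly f p v = 0" for p
  have "op_poly f (monom 1 N + smult (-1) q) v = 0"
    by (simp only: op_poly_add[OF f] op_poly_smult[OF f] op_poly_monom[OF f] q(1)) simp
  moreover have "monom 1 N + smult (-1) q \<noteq> 0"
  proof
    assume "monom 1 N + smult (-1) q = 0"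
    then have "coeff (monom 1 N + smult (-1) q) N = 0" by simp
    then show False using q(2) by simp
  qed
  ultimately have "\<exists>p. P p" unfolding P_def by blast
  then obtain p where p: "P p" "\<And>q. degree q < degree p \<Longrightarrow> \<not> P q"
    using ex_has_least_nat[of P _ degree] by (metis linorder_not_less)
  have "degree p \<noteq> 0"
  proof
    assume "degree p = 0"
    then obtain a where "p = [:a:]" by (rule degree_eq_zeroE)
    with p(1) v(2) show False by (simp add: P_def op_poly_pCons[OF f] lin_0[OF f])
  qed
  then have "\<not> constant (poly p)" by (simp add: constant_degree)
  then obtain c where "poly p c = 0" using fundamental_theorem_of_algebra by blast
  then obtain r where r: "p = [:- c, 1:] * r" by (auto simp: poly_eq_0_iff_dvd)
  have "r \<noteq> 0" using p(1) unfolding P_def r by auto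
  then have "degree r < degree p" unfolding r by (subst degree_mult_eq) auto
  from p(2)[OF this] \<open>r \<noteq> 0\<close> have "op_poly f r v \<noteq> 0" unfolding P_def by blast
  moreover have "op_poly f r v \<in> W"
  proof (induction r)
    case 0
    then show ?case using W(2) by (simp add: subspace_0)
  next
    case (pCons a r)
    then show ?case using W(2,3) v(1) by (auto simp: op_poly_pCons[OF f] intro!: subspace_add subspace_scale)
  qed
  moreover have "f (op_poly f r v) = c *s op_poly f r v"
    using p(1) op_poly_linear_factor[OF f, of c r v] unfolding P_def r by simp
  ultimately show ?thesis by blast
qed

section \<open>Systems of braid operators\<close>

text \<open>For the braid group on \<open>m\<close> strings; operators with index outside
  \<open>1..m-1\<close> are unconstrained. Injectivity stands in for invertibility: on an invariant
  subspace of finite dimension it yields surjectivity (\<open>braid_image_eq\<close>).\<close>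

definition braid_ops :: "nat \<Rightarrow> (nat \<Rightarrow> 'a \<Rightarrow> 'a) \<Rightarrow> bool" where
  "braid_ops m S \<longleftrightarrow>
     (\<forall>i. 1 \<le> i \<and> i < m \<longrightarrow> lin (S i) \<and> inj (S i)) \<and>
     (\<forall>i j x. 1 \<le> i \<and> i + 2 \<le> j \<and> j < m \<longrightarrow> S i (S j x) = S j (S i x)) \<and>
     (\<forall>i x. 1 \<le> i \<and> Suc i < m \<longrightarrow> S i (S (Suc i) (S i x)) = S (Suc i) (S i (S (Suc i) x)))"

definition invariant :: "nat \<Rightarrow> (nat \<Rightarrow> 'a \<Rightarrow> 'a) \<Rightarrow> 'a set \<Rightarrow> bool" where
  "invariant m S W \<longleftrightarrow> subspace W \<and> (\<forall>i x. 1 \<le> i \<and> i < m \<and> x \<in> W \<longrightarrow> S i x \<in> W)"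

definition coincide :: "nat \<Rightarrow> (nat \<Rightarrow> 'a \<Rightarrow> 'a) \<Rightarrow> 'a set \<Rightarrow> bool" where
  "coincide m S W \<longleftrightarrow> (\<forall>i j x. 1 \<le> i \<and> i < m \<and> 1 \<le> j \<and> j < m \<and> x \<in> W \<longrightarrow> S i x = S j x)"

lemma braid_lin: "braid_ops m S \<Longrightarrow> 1 \<le> i \<Longrightarrow> i < m \<Longrightarrow> lin (S i)"
  and braid_inj: "braid_ops m S \<Longrightarrow> 1 \<le> i \<Longrightarrow> i < m \<Longrightarrow> inj (S i)"
  and braid_adj: "braid_ops m S \<Longrightarrow> 1 \<le> i \<Longrightarrow> Suc i < m \<Longrightarrow>
    S i (S (Suc i) (S i x)) = S (Suc i) (S i (S (Suc i) x))"
  by (simp_all add: braid_ops_def)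

lemma braid_far:
  assumes "braid_ops m S" "i + 2 \<le> j \<or> j + 2 \<le> i" "1 \<le> i" "i < m" "1 \<le> j" "j < m"
  shows "S i (S j x) = S j (S i x)"
  using assms unfolding braid_ops_def by metis

lemma braid_ops_shift:
  assumes "braid_ops m S" "m' + k \<le> m"
  shows "braid_ops m' (\<lambda>i. S (i + k))"
proof -
  have "S (i + k) (S (j + k) x) = S (j + k) (S (i + k) x)"
    if "1 \<le> i" "i + 2 \<le> j" "j < m'" for i j x
    using braid_far[OF assms(1), of "i + k" "j + k" x] that assms(2) by simp
  then show ?thesis using assms unfolding braid_ops_def by auto
qed

lemma braid_ops_mono: "braid_ops m S \<Longrightarrow> m' \<le> m \<Longrightarrow> braid_ops m' S"
  using braid_ops_shift[of m S m' 0] by simp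

lemma braid_ops_scale:
  assumes "braid_ops m S" "c \<noteq> 0"
  shows "braid_ops m (\<lambda>i x. c *s S i x)"
proof -
  have "inj (\<lambda>x. c *s f x)" if "inj f" for f :: "'a \<Rightarrow> 'a"
    using that assms(2) by (auto intro!: injI simp: inj_eq)
  moreover have "lin (\<lambda>x. c *s f x)" if "lin f" for f
    by (rule linI) (simp_all add: lin_simps[OF that] scale_right_distrib scale_left_commute)
  moreover have "c *s S i (c *s S j x) = c *s S j (c *s S i x)"
    if "1 \<le> i" "i + 2 \<le> j" "j < m" for i j x
    using braid_far[OF assms(1), of i j x] braid_lin[OF assms(1), of i] braid_lin[OF assms(1), of j] that
    by (simp add: lin_scale)
  moreover have "c *s S i (c *s S (Suc i) (c *s S i x)) =
      c *s S (Suc i) (c *s S i (c *s S (Suc i) x))" if "1 \<le> i" "Suc i < m" for i x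
    using braid_adj[OF assms(1), of i x] braid_lin[OF assms(1), of i]
      braid_lin[OF assms(1), of "Suc i"] that
    by (simp add: lin_scale)
  ultimately show ?thesis
    using braid_lin[OF assms(1)] braid_inj[OF assms(1)] unfolding braid_ops_def by blast
qed

lemma invariant_subspace_of: "invariant m S W \<Longrightarrow> subspace W"
  and invariantD: "invariant m S W \<Longrightarrow> 1 \<le> i \<Longrightarrow> i < m \<Longrightarrow> x \<in> W \<Longrightarrow> S i x \<in> W"
  by (simp_all add: invariant_def)

lemma invariant_shift: "invariant m S W \<Longrightarrow> m' + k \<le> m \<Longrightarrow> invariant m' (\<lambda>i. S (i + k)) W"
  by (simp add: invariant_def)

lemma invariant_mono: "invariant m S W \<Longrightarrow> m' \<le> m \<Longrightarrow> invariant m' S W"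
  by (simp add: invariant_def)

lemma coincideD: "coincide m S W \<Longrightarrow> 1 \<le> i \<Longrightarrow> i < m \<Longrightarrow> 1 \<le> j \<Longrightarrow> j < m \<Longrightarrow> x \<in> W \<Longrightarrow> S i x = S j x"
  unfolding coincide_def by blast

lemma coincide_subset: "coincide m S W \<Longrightarrow> U \<subseteq> W \<Longrightarrow> coincide m S U"
  unfolding coincide_def by blast

section \<open>Criteria for all generators to act by the same operator\<close>

lemma coincideI:
  assumes "\<And>i x. 1 \<le> i \<Longrightarrow> Suc i < m \<Longrightarrow> x \<in> W \<Longrightarrow> S i x = S (Suc i) x"
  shows "coincide m S W"
proof -
  have *: "S (Suc i) x = S 1 x" if "Suc i < m" "x \<in> W" for i x
    using that
  proof (induction i)
    case (Suc i)
    then show ?case using assms[of "Suc i" x] by simp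
  qed simp
  have "S i x = S 1 x" if "1 \<le> i" "i < m" "x \<in> W" for i x
    using *[of "i - 1" x] that by simp
  then show ?thesis unfolding coincide_def by metis
qed

lemma braid_image_eq:
  assumes "braid_ops m S" "invariant m S V" "dim_le V d" "1 \<le> i" "i < m"
  shows "S i ` V = V"
  using assms invariantD[OF assms(2)]
  by (intro inj_image_eq[OF braid_lin braid_inj]) (auto dest: invariant_subspace_of)

lemma invariant_image:
  assumes "invariant m S V" "lin f" "\<And>i x. 1 \<le> i \<Longrightarrow> i < m \<Longrightarrow> x \<in> V \<Longrightarrow> S i (f x) = f (S i x)"
  shows "invariant m S (f ` V)"
  using assms subspace_lin_image[OF assms(2)] by (auto simp: invariant_def)

lemma invariant_eigenspace:
  assumes "invariant m S V" "\<And>i. 1 \<le> i \<Longrightarrow> i < m \<Longrightarrow> lin (S i)" "lin f"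
    "\<And>i x. 1 \<le> i \<Longrightarrow> i < m \<Longrightarrow> x \<in> V \<Longrightarrow> S i (f x) = f (S i x)"
  shows "invariant m S {x\<in>V. f x = c *s x}"
proof -
  have "subspace {x\<in>V. f x = c *s x}"
    using invariant_subspace_of[OF assms(1)] assms(3)
    by (intro subspaceI)
      (auto simp: subspace_0 subspace_add subspace_scale lin_simps scale_right_distrib scale_left_commute)
  moreover have "f (S i x) = c *s S i x" if "1 \<le> i" "i < m" "x \<in> V" "f x = c *s x" for i x
    using assms(4)[OF that(1-3)] lin_scale[OF assms(2)[OF that(1,2)], of c x] that(4) by simp
  ultimately show ?thesis using assms(1) by (simp add: invariant_def)
qed

text \<open>The operators agree on \<open>W\<close> and modulo \<open>W\<close>. Put
  \<open>T = S_1\<close> and \<open>D_i = S_i - T\<close>. Since \<open>D_i\<close> maps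
  \<open>V\<close> into \<open>W\<close>, where every \<open>S_j\<close> acts as \<open>T\<close>,
  products of the \<open>S_i\<close> contain only terms of first order in the \<open>D_i\<close>.
  The far relations make \<open>T\<close> commute with each \<open>D_i\<close>, and then the braid
  relations force the \<open>D_i\<close> to be equal.\<close>

lemma coincide_extend:
  assumes B: "braid_ops m S" "5 \<le> m" and V: "invariant m S V" and W: "invariant m S W" "coincide m S W"
    and D: "\<And>i j x. 1 \<le> i \<Longrightarrow> i < m \<Longrightarrow> 1 \<le> j \<Longrightarrow> j < m \<Longrightarrow> x \<in> V \<Longrightarrow> S i x - S j x \<in> W"
  shows "coincide m S V"
proof -
  define T where "T = S 1"
  define D where "D i x = S i x - T x" for i x
  have T: "lin T" "inj T" using braid_lin[OF B(1)] braid_inj[OF B(1)] B(2) by (auto simp: T_def)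
  have TV: "T x \<in> V" if "x \<in> V" for x using V that B(2) by (simp add: T_def invariantD)
  have TW: "T x \<in> W" if "x \<in> W" for x using W that B(2) by (simp add: T_def invariantD)
  have SW: "S i x = T x" if "1 \<le> i" "i < m" "x \<in> W" for i x
    using coincideD[OF W(2) that(1,2) _ _ that(3), of 1] B(2) by (simp add: T_def)
  have DW: "D i x \<in> W" if "1 \<le> i" "i < m" "x \<in> V" for i x
    using assms(6)[of i 1 x] that B(2) by (simp add: D_def T_def)
  have S: "S i x = T x + D i x" for i x by (simp add: D_def)
  have SS: "S i (S j x) = T (T x) + D i (T x) + T (D j x)"
    if "1 \<le> i" "i < m" "1 \<le> j" "j < m" "x \<in> V" for i j x
  proof -
    have "S i (S j x) = S i (T x) + S i (D j x)"
      using lin_add[OF braid_lin[OF B(1) that(1,2)]] S[of j x] by simp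
    then show ?thesis using SW[OF that(1,2) DW[OF that(3,4,5)]] S[of i "T x"] by simp
  qed
  have far: "D i (T x) + T (D j x) = D j (T x) + T (D i x)"
    if "i + 2 \<le> j" "1 \<le> i" "i < m" "1 \<le> j" "j < m" "x \<in> V" for i j x
    using braid_far[OF B(1) disjI1[OF that(1)] that(2-5), of x] SS[OF that(2-6)] SS[OF that(4,5,2,3,6)]
    by (simp add: add.assoc)
  have D1: "D (Suc 0) x = 0" for x by (simp add: D_def T_def)
  have c3: "T (D j x) = D j (T x)" if "3 \<le> j" "j < m" "x \<in> V" for j x
    using far[of 1 j x] that by (simp add: D1 lin_0[OF T(1)])
  \<comment> \<open>Index 4 is far from 2 and already settled by \<open>c3\<close>, so the far
    relation for the pair 2, 4 settles index 2; this is where \<open>5 \<le> m\<close>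
    enters.\<close>
  have c2: "T (D 2 x) = D 2 (T x)" if "x \<in> V" for x
  proof -
    have "D 2 (T x) + T (D 4 x) = D 4 (T x) + T (D 2 x)"
      by (rule far) (use that B(2) in auto)
    moreover have "T (D 4 x) = D 4 (T x)" by (rule c3) (use that B(2) in auto)
    ultimately show ?thesis by (metis add.commute add_left_cancel)
  qed
  have c: "T (D j x) = D j (T x)" if "1 \<le> j" "j < m" "x \<in> V" for j x
  proof -
    have "j = 1 \<or> j = 2 \<or> 3 \<le> j" using that by auto
    then show ?thesis using c2 c3 that by (auto simp: D1 lin_0[OF T(1)])
  qed
  show ?thesis
  proof (rule coincideI)
    fix i x assume i: "1 \<le> i" "Suc i < m" "x \<in> V"
    \<comment> \<open>A braid word is \<open>T^3 + 2 T^2 D_a + T^2 D_b\<close>; comparing the two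
      orders leaves \<open>T^2 D_a = T^2 D_b\<close>, and \<open>T\<close> is injective.\<close>
    have SSS: "S a (S b (S a x)) = T (T (T x)) + T (T (D a x)) + T (T (D a x)) + T (T (D b x))"
      if "1 \<le> a" "a < m" "1 \<le> b" "b < m" for a b
    proof -
      have "S b (S a x) = T (T x) + T (D b x + D a x)"
        using SS[OF that(3,4,1,2) i(3)] c[OF that(3,4) i(3)] by (simp add: lin_add[OF T(1)] add.assoc)
      then have "S a (S b (S a x)) = S a (T (T x)) + S a (T (D b x + D a x))"
        using lin_add[OF braid_lin[OF B(1) that(1,2)]] by simp
      also have "S a (T (D b x + D a x)) = T (T (D b x + D a x))"
        using DW[OF that(1,2) i(3)] DW[OF that(3,4) i(3)] invariant_subspace_of[OF W(1)]
        by (intro SW[OF that(1,2)] TW) (simp add: subspace_add)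
      also have "S a (T (T x)) = T (T (T x)) + T (T (D a x))"
        using c[OF that(1,2)] TV i(3) S by simp
      finally show ?thesis by (simp add: lin_add[OF T(1)] add_ac)
    qed
    have "T (T (D i x)) = T (T (D (Suc i) x))"
      using braid_adj[OF B(1) i(1,2), of x] SSS[of i "Suc i"] SSS[of "Suc i" i] i by (simp add: add_ac)
    then have "D i x = D (Suc i) x" using T(2) by (simp add: inj_eq)
    then show "S i x = S (Suc i) x" by (simp add: D_def)
  qed
qed

lemma coincide_trivial: "braid_ops m S \<Longrightarrow> V \<subseteq> {0} \<Longrightarrow> coincide m S V"
  using lin_0[OF braid_lin, of m S] by (auto simp: coincide_def dest!: subsetD)

text \<open>The image of \<open>A - c\<close> is the quotient of \<open>V\<close> by the eigenspace, which allows an induction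
  on the dimension without forming quotient spaces.\<close>

lemma coincide_of_eigenspaces:
  assumes B: "braid_ops m S" "5 \<le> m" and A: "lin A"
    and comm: "\<And>i x. 1 \<le> i \<Longrightarrow> i < m \<Longrightarrow> S i (A x) = A (S i x)"
    and "dim_le V d" "invariant m S V" "A ` V \<subseteq> V" "\<And>c. coincide m S {x\<in>V. A x = c *s x}"
  shows "coincide m S V"
  using assms(5-8)
proof (induction d arbitrary: V rule: less_induct)
  case (less d)
  note V = less.prems
  note sV = invariant_subspace_of[OF V(2)]
  show ?case
  proof (cases "V \<subseteq> {0}")
    case True
    then show ?thesis using coincide_trivial[OF B(1)] by blast
  next
    case False
    then obtain c v where v: "v \<in> V" "v \<noteq> 0" "A v = c *s v"
      using exists_eigenvector[OF A V(1) sV V(3)] by blast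
    define f where "f x = A x - c *s x" for x
    let ?K = "{x\<in>V. A x = c *s x}"
    have f: "lin f" unfolding f_def[abs_def] using A by (rule lin_shift)
    have Sf: "S i (f x) = f (S i x)" if "1 \<le> i" "i < m" for i x
      using comm[OF that] by (simp add: f_def lin_simps[OF braid_lin[OF B(1) that]])
    have "\<not> dim_le {x\<in>V. f x = 0} 0" using v by (auto simp: dim_le_0 f_def)
    from dim_le_image_kernel[OF f V(1) sV this]
    have d: "dim_le (f ` V) (d - Suc 0)" "Suc 0 \<le> d" by auto
    have fV: "f ` V \<subseteq> V" using V(3) sV by (auto simp: f_def intro!: subspace_diff subspace_scale)
    have "coincide m S (f ` V)"
    proof (rule less.IH)
      show "d - Suc 0 < d" using d(2) by simp
      show "dim_le (f ` V) (d - Suc 0)" by (rule d(1))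
      show "invariant m S (f ` V)" using V(2) f by (rule invariant_image) (rule Sf)
      show "A ` f ` V \<subseteq> f ` V"
      proof -
        have "A (f x) = f (A x)" for x by (simp add: f_def lin_simps[OF A])
        then show ?thesis using V(3) by auto
      qed
      show "coincide m S {x \<in> f ` V. A x = c *s x}" for c
        using V(4)[of c] fV by (rule_tac coincide_subset) auto
    qed
    show ?thesis
    \<comment> \<open>Since \<open>f\<close> commutes with the generators, their agreement on the
      image of \<open>f\<close> says that their differences map \<open>V\<close> into the kernel of
      \<open>f\<close>, which is the eigenspace \<open>?K\<close>.\<close>
    proof (rule coincide_extend[OF B V(2)])
      show "invariant m S ?K"
        using V(2) braid_lin[OF B(1)] A comm by (rule invariant_eigenspace)
      show "coincide m S ?K" by (rule V(4))
      fix i j x assume ij: "1 \<le> i" "i < m" "1 \<le> j" "j < m" "x \<in> V"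
      have "f (S i x - S j x) = S i (f x) - S j (f x)"
        unfolding Sf[OF ij(1,2)] Sf[OF ij(3,4)] by (rule lin_diff[OF f])
      also have "\<dots> = 0" using coincideD[OF \<open>coincide m S (f ` V)\<close> ij(1-4)] ij(5) by simp
      finally show "S i x - S j x \<in> ?K"
        using ij V(2) sV by (simp add: f_def subspace_diff invariantD)
    qed
  qed
qed

lemma dim_le_1_multiple:
  assumes "dim_le V 1" "x \<in> V" "x \<noteq> 0" "y \<in> V"
  shows "\<exists>c. y = c *s x"
proof (rule ccontr)
  assume *: "\<not> ?thesis"
  have "y \<notin> span {x}" using * by (auto simp: span_singleton)
  then have "independent {y, x}" using assms(3) by (simp add: independent_insertI)
  moreover have "y \<noteq> x" using * scale_one[of x] by metis
  ultimately show False using dim_le_independent[OF assms(1), of "{y, x}"] assms(2,4) by simp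
qed

text \<open>On a line two neighbouring generators are nonzero scalars with
  \<open>a b a = b a b\<close>, hence \<open>a = b\<close>.\<close>

lemma coincide_line:
  assumes B: "braid_ops m S" and V: "invariant m S V" "dim_le V 1"
  shows "coincide m S V"
proof (rule coincideI)
  fix i x assume i: "1 \<le> i" "Suc i < m" "x \<in> V"
  have l: "lin (S i)" "lin (S (Suc i))" using braid_lin[OF B] i by auto
  show "S i x = S (Suc i) x"
  proof (cases "x = 0")
    case True
    then show ?thesis using l by (simp add: lin_0)
  next
    case False
    obtain a b where ab: "S i x = a *s x" "S (Suc i) x = b *s x"
      using dim_le_1_multiple[OF V(2) i(3) False] invariantD[OF V(1)] i by (metis Suc_lessD le_SucI)
    have "S i x \<noteq> S i 0" "S (Suc i) x \<noteq> S (Suc i) 0"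
      using False braid_inj[OF B, of i] braid_inj[OF B, of "Suc i"] i by (auto simp: inj_eq)
    then have "a \<noteq> 0" "b \<noteq> 0" using ab l by (auto simp: lin_0)
    moreover have "(a * b * a) *s x = (b * a * b) *s x"
      using braid_adj[OF B i(1,2), of x] l by (simp add: ab lin_scale ac_simps)
    ultimately show ?thesis using False ab by auto
  qed
qed

lemma commute_imp_eq:
  assumes B: "braid_ops m S" "1 \<le> i" "Suc i < m"
    and "S i (S (Suc i) x) = S (Suc i) (S i x)" "S i (S (Suc i) (S i x)) = S (Suc i) (S i (S i x))"
  shows "S i x = S (Suc i) x"
proof -
  have "S (Suc i) (S i (S i x)) = S (Suc i) (S i (S (Suc i) x))"
    using braid_adj[OF B, of x] assms(5) by simp
  then show ?thesis using braid_inj[OF B(1)] B(2,3) by (simp add: inj_eq)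
qed

text \<open>If \<open>S_(i+2) = S_(i+1)\<close> on \<open>V\<close>, then \<open>S_i\<close>, which
  commutes with the former, commutes with the latter, and the braid relation collapses to
  \<open>S_i = S_(i+1)\<close>. Starting from \<open>S_4 = S_3\<close> this gives
  \<open>S_2 = S_3\<close> and then \<open>S_1 = S_2\<close>.\<close>

lemma coincide_of_shift:
  assumes B: "braid_ops m S" "5 \<le> m" and V: "invariant m S V"
    and "coincide (m - 2) (\<lambda>i. S (i + 2)) V"
  shows "coincide m S V"
proof -
  have 3: "S i x = S 3 x" if "3 \<le> i" "i < m" "x \<in> V" for i x
  proof -
    have "S (i - 2 + 2) x = S (1 + 2) x"
      by (rule coincideD[OF assms(4)]) (use that in auto)
    moreover have "i - 2 + 2 = i" "1 + 2 = (3::nat)" using that by auto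
    ultimately show ?thesis by (simp only:)
  qed
  have step: "S i x = S (Suc i) x"
    if i: "1 \<le> i" "i + 2 < m" "x \<in> V" and eq: "\<And>y. y \<in> V \<Longrightarrow> S (i + 2) y = S (Suc i) y" for i x
  proof -
    have comm: "S i (S (Suc i) y) = S (Suc i) (S i y)" if "y \<in> V" for y
    proof -
      have "S i (S (i + 2) y) = S (i + 2) (S i y)"
        by (rule braid_far[OF B(1)]) (use i in auto)
      moreover have "S i y \<in> V" using invariantD[OF V _ _ that] i by simp
      ultimately show ?thesis using eq that by simp
    qed
    have "S i x \<in> V" using invariantD[OF V _ _ i(3)] i by simp
    from commute_imp_eq[OF B(1) i(1) _ comm[OF i(3)]] comm[OF this] i(2) show ?thesis by simp
  qed
  have 2: "S 2 x = S 3 x" if "x \<in> V" for x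
    using step[OF _ _ that, of 2] 3[of 4] B(2) by (simp add: eval_nat_numeral)
  have 1: "S 1 x = S 2 x" if "x \<in> V" for x
    using step[OF _ _ that, of 1] 2 B(2) by (simp add: eval_nat_numeral)
  have "S i x = S 3 x" if "1 \<le> i" "i < m" "x \<in> V" for i x
  proof -
    have "i = 1 \<or> i = 2 \<or> 3 \<le> i" using that by auto
    then show ?thesis using 1 2 3 that by auto
  qed
  then show ?thesis unfolding coincide_def by metis
qed

section \<open>Conjugation of each generator to the next one\<close>

lemma braid_conj:
  assumes "braid_ops m S" "1 \<le> i" "Suc i < m"
  obtains g where "lin g" "inj g" "\<And>x. g x = S i (S (Suc i) x)" "\<And>x. S (Suc i) (g x) = g (S i x)"
    "\<And>V d. invariant m S V \<Longrightarrow> dim_le V d \<Longrightarrow> g ` V = V"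
proof
  define g where "g x = S i (S (Suc i) x)" for x
  show "g x = S i (S (Suc i) x)" for x by (simp add: g_def)
  have l: "lin (S i)" "lin (S (Suc i))" using braid_lin[OF assms(1)] assms by auto
  then show "lin g" by (intro linI) (simp_all add: g_def lin_simps)
  have "inj (S i)" "inj (S (Suc i))" using braid_inj[OF assms(1)] assms by auto
  then show "inj g" by (auto intro!: injI simp: g_def inj_eq)
  \<comment> \<open>For \<open>g = S_i S_(i+1)\<close> this is the braid relation itself.\<close>
  show "S (Suc i) (g x) = g (S i x)" for x
    using braid_adj[OF assms, of x] by (simp only: g_def)
  show "g ` V = V" if V: "invariant m S V" "dim_le V d" for V d
  proof -
    have "g ` V = S i ` S (Suc i) ` V" by (simp add: g_def image_image)
    then show ?thesis
      using braid_image_eq[OF assms(1) V, of i] braid_image_eq[OF assms(1) V, of "Suc i"] assms by simp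
  qed
qed

lemma dim_le_image_conj:
  assumes B: "braid_ops m S" and V: "invariant m S V" "dim_le V d"
    and "dim_le ((\<lambda>x. S 1 x - c *s x) ` V) k" "1 \<le> i" "i < m"
  shows "dim_le ((\<lambda>x. S i x - c *s x) ` V) k"
  using assms(5,6)
proof (induction i rule: nat_induct_at_least)
  case base
  then show ?case using assms(4) by simp
next
  case (Suc i)
  obtain g where g: "lin g" "inj g" "\<And>x. S (Suc i) (g x) = g (S i x)" "g ` V = V"
    using braid_conj[OF B Suc(1,3)] V by metis
  have "(\<lambda>x. S (Suc i) x - c *s x) ` V = (\<lambda>x. S (Suc i) x - c *s x) ` g ` V" using g(4) by simp
  also have "\<dots> = g ` (\<lambda>x. S i x - c *s x) ` V"
    by (simp add: image_image g(3) lin_simps[OF g(1)])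
  finally show ?case using dim_le_image[OF g(1)] Suc by simp
qed

lemma dim_le_eigenspace_conj:
  assumes B: "braid_ops m S" and V: "invariant m S V" "dim_le V d"
    and "dim_le {x\<in>V. S 1 x = c *s x} k" "1 \<le> i" "i < m"
  shows "dim_le {x\<in>V. S i x = c *s x} k"
  using assms(5,6)
proof (induction i rule: nat_induct_at_least)
  case base
  then show ?case using assms(4) by simp
next
  case (Suc i)
  obtain g where g: "lin g" "inj g" "\<And>x. S (Suc i) (g x) = g (S i x)" "g ` V = V"
    using braid_conj[OF B Suc(1,3)] V by metis
  have "{x\<in>V. S (Suc i) x = c *s x} \<subseteq> g ` {x\<in>V. S i x = c *s x}"
  proof
    fix y assume y: "y \<in> {x\<in>V. S (Suc i) x = c *s x}"
    then obtain x where x: "x \<in> V" "y = g x" using g(4) by blast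
    have "g (S i x) = g (c *s x)" using y by (simp add: x g(3) lin_scale[OF g(1)])
    then have "S i x = c *s x" using g(2) by (simp add: inj_eq)
    with x show "y \<in> g ` {x\<in>V. S i x = c *s x}" by blast
  qed
  moreover have "dim_le {x\<in>V. S i x = c *s x} k" using Suc by simp
  ultimately show ?case using dim_le_subset dim_le_image[OF g(1)] by blast
qed

section \<open>The operators \<open>A_i = S_i - 1\<close> and the braid relations in terms of
  them\<close>

definition disp :: "(nat \<Rightarrow> 'a \<Rightarrow> 'a) \<Rightarrow> nat \<Rightarrow> 'a \<Rightarrow> 'a" where
  "disp S i x = S i x - x"

definition far_zero :: "nat \<Rightarrow> (nat \<Rightarrow> 'a \<Rightarrow> 'a) \<Rightarrow> 'a set \<Rightarrow> bool" where
  "far_zero m S V \<longleftrightarrow> (\<forall>i j. 1 \<le> i \<and> i < m \<and> 1 \<le> j \<and> j < m \<and> (i + 2 \<le> j \<or> j + 2 \<le> i) \<longrightarrow>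
     (\<forall>x\<in>V. disp S i (disp S j x) = 0))"

definition tri :: "(nat \<Rightarrow> 'a \<Rightarrow> 'a) \<Rightarrow> nat \<Rightarrow> 'a \<Rightarrow> 'a" where
  "tri S i x = disp S i (disp S (Suc i) (disp S i x)) + disp S i (disp S i x) + disp S i x"

lemma lin_disp: "lin (S i) \<Longrightarrow> lin (disp S i)"
  using lin_shift[of "S i" 1] by (simp add: disp_def[abs_def])

lemma disp_in: "invariant m S V \<Longrightarrow> 1 \<le> i \<Longrightarrow> i < m \<Longrightarrow> x \<in> V \<Longrightarrow> disp S i x \<in> V"
  by (simp add: disp_def invariantD invariant_subspace_of subspace_diff)

lemma disp_comm:
  assumes "braid_ops m S" "i + 2 \<le> j \<or> j + 2 \<le> i" "1 \<le> i" "i < m" "1 \<le> j" "j < m"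
  shows "disp S i (disp S j x) = disp S j (disp S i x)"
    and "S i (disp S j x) = disp S j (S i x)"
  using braid_far[OF assms, of x] lin_diff[OF braid_lin[OF assms(1,3,4)]] lin_diff[OF braid_lin[OF assms(1,5,6)]]
  by (simp_all add: disp_def)

text \<open>Expanding the braid relation in \<open>S_i = 1 + A_i\<close> and cancelling the common
  terms leaves exactly the symmetry of \<open>tri\<close> in \<open>i\<close> and
  \<open>i + 1\<close>.\<close>

lemma tri_alt:
  assumes "braid_ops m S" "1 \<le> i" "Suc i < m"
  shows "tri S i x = disp S (Suc i) (disp S i (disp S (Suc i) x)) + disp S (Suc i) (disp S (Suc i) x)
    + disp S (Suc i) x"
proof -
  have "lin (S i)" "lin (S (Suc i))" using braid_lin[OF assms(1)] assms by auto
  then show ?thesis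
    using braid_adj[OF assms, of x] by (simp add: tri_def disp_def lin_simps algebra_simps)
qed

lemma lin_tri: "lin (S i) \<Longrightarrow> lin (S (Suc i)) \<Longrightarrow> lin (tri S i)"
  by (rule linI) (simp_all add: tri_def disp_def lin_simps scale_right_distrib scale_right_diff_distrib)

lemma tri_in:
  assumes "invariant m S V" "1 \<le> i" "Suc i < m" "x \<in> V"
  shows "tri S i x \<in> V"
  using assms invariant_subspace_of[OF assms(1)] unfolding tri_def
  by (intro subspace_add disp_in[OF assms(1)]) auto

lemma far_zeroD:
  assumes "far_zero m S V" "1 \<le> i" "i < m" "1 \<le> j" "j < m" "i + 2 \<le> j \<or> j + 2 \<le> i" "x \<in> V"
  shows "disp S i (disp S j x) = 0"
  using assms unfolding far_zero_def by blast

text \<open>A product of three consecutive generators shifts both \<open>S_i\<close> and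
  \<open>S_(i+1)\<close> by one index at the same time, and hence also \<open>tri\<close>, which
  involves both of them.\<close>

lemma tri_conj:
  assumes B: "braid_ops m S" "1 \<le> i" "i + 2 < m"
  obtains g where "lin g" "inj g" "\<And>x. g x = S i (S (i + 1) (S (i + 2) x))"
    "\<And>x. S (i + 1) (g x) = g (S i x)" "\<And>x. S (i + 2) (g x) = g (S (i + 1) x)"
    "\<And>x. tri S (i + 1) (g x) = g (tri S i x)"
    "\<And>V d. invariant m S V \<Longrightarrow> dim_le V d \<Longrightarrow> g ` V = V"
proof
  define g where "g x = S i (S (i + 1) (S (i + 2) x))" for x
  show "g x = S i (S (i + 1) (S (i + 2) x))" for x by (simp add: g_def)
  have l: "lin (S i)" "lin (S (i + 1))" "lin (S (i + 2))" using braid_lin[OF B(1)] B by auto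
  then show g: "lin g" by (intro linI) (simp_all add: g_def lin_simps)
  have "inj (S i)" "inj (S (i + 1))" "inj (S (i + 2))" using braid_inj[OF B(1)] B by auto
  then show "inj g" by (auto intro!: injI simp: g_def inj_eq)
  show 1: "S (i + 1) (g x) = g (S i x)" for x
  proof -
    have "S (i + 2) (S i x) = S i (S (i + 2) x)"
      by (rule braid_far[OF B(1)]) (use B in auto)
    moreover have "S i (S (i + 1) (S i (S (i + 2) x))) = S (i + 1) (S i (S (i + 1) (S (i + 2) x)))"
      using braid_adj[OF B(1,2), of "S (i + 2) x"] B(3) by simp
    ultimately show ?thesis by (simp only: g_def)
  qed
  show 2: "S (i + 2) (g x) = g (S (i + 1) x)" for x
  proof -
    have "S (i + 2) (S i (S (i + 1) (S (i + 2) x))) = S i (S (i + 2) (S (i + 1) (S (i + 2) x)))"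
      by (rule braid_far[OF B(1)]) (use B in auto)
    moreover have "S (i + 2) (S (i + 1) (S (i + 2) x)) = S (i + 1) (S (i + 2) (S (i + 1) x))"
      using braid_adj[OF B(1), of "i + 1" x] B(3) by simp
    ultimately show ?thesis by (simp only: g_def)
  qed
  have d: "disp S (i + 1) (g x) = g (disp S i x)" "disp S (i + 2) (g x) = g (disp S (i + 1) x)" for x
    by (simp_all only: disp_def 1 2 lin_diff[OF g])
  show "tri S (i + 1) (g x) = g (tri S i x)" for x
  proof -
    have "Suc (i + 1) = i + 2" "Suc i = i + 1" by simp_all
    then show ?thesis unfolding tri_def by (simp only: d lin_add[OF g])
  qed
  show "g ` V = V" if V: "invariant m S V" "dim_le V d" for V d
  proof -
    have "g ` V = S i ` S (i + 1) ` S (i + 2) ` V" by (simp add: g_def image_image)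
    then show ?thesis
      using braid_image_eq[OF B(1) V, of i] braid_image_eq[OF B(1) V, of "i + 1"]
        braid_image_eq[OF B(1) V, of "i + 2"] B by simp
  qed
qed

lemma tri_zero_propagate:
  assumes B: "braid_ops m S" and V: "invariant m S V" "dim_le V d"
    and "\<And>x. x \<in> V \<Longrightarrow> tri S 1 x = 0" "1 \<le> i" "Suc i < m" "x \<in> V"
  shows "tri S i x = 0"
  using assms(5-7)
proof (induction i arbitrary: x rule: nat_induct_at_least)
  case base
  then show ?case using assms(4) by simp
next
  case (Suc i)
  have "i + 2 < m" using Suc by simp
  then obtain g where g: "lin g" "\<And>x. tri S (i + 1) (g x) = g (tri S i x)" "g ` V = V"
    using tri_conj[OF B Suc(1)] V by metis
  then obtain y where "y \<in> V" "x = g y" using Suc.prems by blast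
  with Suc g show ?case by (simp add: lin_0)
qed

text \<open>By \<open>c1\<close> the space \<open>A_j A_1 V\<close> does not depend on
  \<open>j \<ge> 3\<close>, and by \<open>c2\<close> the factor \<open>A_1\<close> in
  \<open>A_1 A_(m-1) V\<close> may be replaced by \<open>A_2\<close>. So \<open>X\<close> has many
  descriptions \<open>A_i A_j V\<close>, and each generator commutes with both factors in one of
  them.\<close>

lemma far_commute_invariant:
  assumes B: "braid_ops m S" "5 \<le> m" and V: "invariant m S V"
    and c1: "coincide (m - 2) (\<lambda>i. S (i + 2)) (disp S 1 ` V)"
    and c2: "coincide (m - 2) S (disp S (m - 1) ` V)"
    and X_def: "X = (\<lambda>x. disp S 3 (disp S 1 x)) ` V"
  shows "invariant m S X" "\<And>i. 1 \<le> i \<Longrightarrow> i < m \<Longrightarrow> X \<subseteq> disp S i ` V"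
    "\<And>j x. 3 \<le> j \<Longrightarrow> j < m \<Longrightarrow> x \<in> V \<Longrightarrow> disp S 1 (disp S j x) \<in> X"
proof -
  have X1: "X = (\<lambda>x. disp S j (disp S 1 x)) ` V" if "3 \<le> j" "j < m" for j
  proof -
    have "S j y = S 3 y" if y: "y \<in> disp S 1 ` V" for y
    proof -
      have "S (j - 2 + 2) y = S (1 + 2) y"
        by (rule coincideD[OF c1]) (use that \<open>3 \<le> j\<close> \<open>j < m\<close> in auto)
      moreover have "j - 2 + 2 = j" "1 + 2 = (3::nat)" using \<open>3 \<le> j\<close> by auto
      ultimately show ?thesis by (simp only:)
    qed
    then show ?thesis unfolding X_def by (intro image_cong HOL.refl) (simp add: disp_def[of S 3] disp_def[of S j])
  qed
  have X1': "X = (\<lambda>x. disp S 1 (disp S j x)) ` V" if "3 \<le> j" "j < m" for j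
  proof -
    have "disp S j (disp S 1 x) = disp S 1 (disp S j x)" for x
      by (rule disp_comm(1)[OF B(1)]) (use that in auto)
    then show ?thesis using X1[OF that] by simp
  qed
  \<comment> \<open>The hypothesis \<open>c2\<close> concerns the indices up to
    \<open>m - 3\<close>; these include 2 because \<open>5 \<le> m\<close>.\<close>
  have X2: "X = (\<lambda>x. disp S 2 (disp S (m - 1) x)) ` V"
  proof -
    have "S 1 y = S 2 y" if y: "y \<in> disp S (m - 1) ` V" for y
      by (rule coincideD[OF c2]) (use that B(2) in auto)
    then have "(\<lambda>x. disp S 1 (disp S (m - 1) x)) ` V = (\<lambda>x. disp S 2 (disp S (m - 1) x)) ` V"
      by (intro image_cong HOL.refl) (simp add: disp_def[of S "Suc 0"] disp_def[of S 2])
    moreover have "X = (\<lambda>x. disp S 1 (disp S (m - 1) x)) ` V" by (rule X1') (use B(2) in auto)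
    ultimately show ?thesis by simp
  qed
  show sub: "X \<subseteq> disp S i ` V" if i: "1 \<le> i" "i < m" for i
  proof -
    have "i = 1 \<or> i = 2 \<or> 3 \<le> i" using i by auto
    then consider "i = 1" | "i = 2" | "3 \<le> i" by blast
    then show ?thesis
    proof cases
      case 1
      have "X = (\<lambda>x. disp S 1 (disp S 3 x)) ` V" by (rule X1') (use B(2) in auto)
      moreover have "disp S 3 x \<in> V" if "x \<in> V" for x
        using disp_in[OF V _ _ that, of 3] B(2) by simp
      ultimately show ?thesis using 1 by blast
    next
      case 2
      have "disp S (m - 1) x \<in> V" if "x \<in> V" for x
        using disp_in[OF V _ _ that, of "m - 1"] B(2) by simp
      then show ?thesis using X2 2 by blast
    next
      case 3
      have "disp S 1 x \<in> V" if "x \<in> V" for x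
        using disp_in[OF V _ _ that, of 1] B(2) by simp
      then show ?thesis using X1[OF 3 i(2)] by blast
    qed
  qed
  show "disp S 1 (disp S j x) \<in> X" if "3 \<le> j" "j < m" "x \<in> V" for j x
    using X1'[OF that(1,2)] that(3) by blast
  have inv: "S k y \<in> X" if k: "1 \<le> k" "k < m" "y \<in> X" for k y
  proof -
    \<comment> \<open>Indices equal to \<open>k\<close> or far from \<open>k\<close>: the pairs are
      \<open>(3, 1)\<close> for \<open>k = 1\<close>, \<open>(2, m - 1)\<close> for
      \<open>k = 2\<close>, and \<open>(k, 1)\<close> otherwise.\<close>
    have "\<exists>i j. 1 \<le> i \<and> i < m \<and> 1 \<le> j \<and> j < m \<and> (k + 2 \<le> i \<or> i + 2 \<le> k \<or> k = i) \<and> (k + 2 \<le> j \<or> j + 2 \<le> k \<or> k = j)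
        \<and> X = (\<lambda>x. disp S i (disp S j x)) ` V"
    proof -
      have "k = 1 \<or> k = 2 \<or> 3 \<le> k" using k by auto
      then consider "k = 1" | "k = 2" | "3 \<le> k" by blast
      then show ?thesis
      proof cases
        case 1
        then show ?thesis using X1[of 3] B(2) by (intro exI[of _ 3] exI[of _ 1]) auto
      next
        case 2
        then show ?thesis using X2 B(2) by (intro exI[of _ 2] exI[of _ "m - 1"]) auto
      next
        case 3
        then show ?thesis using X1[of k] k B(2) by (intro exI[of _ k] exI[of _ 1]) auto
      qed
    qed
    then obtain i j where ij: "1 \<le> i" "i < m" "1 \<le> j" "j < m" "k + 2 \<le> i \<or> i + 2 \<le> k \<or> k = i"
      "k + 2 \<le> j \<or> j + 2 \<le> k \<or> k = j" "X = (\<lambda>x. disp S i (disp S j x)) ` V" by blast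
    have c: "S k (disp S i x) = disp S i (S k x)" if "1 \<le> i" "i < m" "k + 2 \<le> i \<or> i + 2 \<le> k \<or> k = i" for i x
      using disp_comm(2)[OF B(1) _ k(1,2) that(1,2), of x] that(3) lin_diff[OF braid_lin[OF B(1) k(1,2)]] by (auto simp: disp_def)
    obtain x where x: "x \<in> V" "y = disp S i (disp S j x)" using k(3) ij(7) by blast
    have "S k y = disp S i (disp S j (S k x))"
      unfolding x(2) c[OF ij(1,2,5)] c[OF ij(3,4,6)] ..
    then show ?thesis using ij(7) invariantD[OF V k(1,2) x(1)] by blast
  qed
  have "lin (\<lambda>x. disp S 3 (disp S 1 x))"
  proof -
    have "lin (disp S 1)" "lin (disp S 3)" using B(2) by (auto intro!: lin_disp braid_lin[OF B(1)])
    then show ?thesis by (intro linI) (simp_all add: lin_simps)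
  qed
  then have "subspace X" unfolding X_def by (rule subspace_lin_image[OF _ invariant_subspace_of[OF V]])
  then show "invariant m S X" using inv by (simp add: invariant_def)
qed

text \<open>Conjugation by \<open>S_i S_(i+1)\<close> raises the smaller index by one, and it
  commutes with \<open>S_j\<close> as long as \<open>i + 3 \<le> j\<close>. The other order of the
  two factors follows because they commute.\<close>

lemma far_zeroI:
  assumes B: "braid_ops m S" and V: "invariant m S V" "dim_le V d"
    and z: "\<And>j x. 3 \<le> j \<Longrightarrow> j < m \<Longrightarrow> x \<in> V \<Longrightarrow> disp S 1 (disp S j x) = 0"
  shows "far_zero m S V"
proof -
  have *: "disp S i (disp S j x) = 0" if "1 \<le> i" "i + 2 \<le> j" "j < m" "x \<in> V" for i j x
    using that
  proof (induction i arbitrary: x rule: nat_induct_at_least)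
    case base
    then show ?case using z by simp
  next
    case (Suc i)
    have "Suc i < m" using Suc by simp
    then obtain g where g: "lin g" "\<And>x. g x = S i (S (Suc i) x)" "\<And>x. S (Suc i) (g x) = g (S i x)" "g ` V = V"
      using braid_conj[OF B Suc(1)] V by metis
    then obtain y where y: "y \<in> V" "x = g y" using Suc.prems by blast
    have "S j (S i z) = S i (S j z)" "S j (S (Suc i) z) = S (Suc i) (S j z)" for z
      using braid_far[OF B, of j i z] braid_far[OF B, of j "Suc i" z] Suc by auto
    then have j: "S j (g y) = g (S j y)" by (simp only: g(2))
    have "disp S (Suc i) (g z) = g (disp S i z)" for z
      by (simp only: disp_def g(3) lin_diff[OF g(1)])
    moreover have "disp S j (g y) = g (disp S j y)" by (simp only: disp_def j lin_diff[OF g(1)])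
    ultimately have "disp S (Suc i) (disp S j (g y)) = g (disp S i (disp S j y))" by simp
    also have "\<dots> = 0" using Suc y(1) by (simp add: lin_0[OF g(1)])
    finally show ?case by (simp only: y(2))
  qed
  show ?thesis unfolding far_zero_def
  proof (intro allI impI ballI)
    fix i j x assume ij: "1 \<le> i \<and> i < m \<and> 1 \<le> j \<and> j < m \<and> (i + 2 \<le> j \<or> j + 2 \<le> i)" "x \<in> V"
    show "disp S i (disp S j x) = 0"
    proof (cases "i + 2 \<le> j")
      case True
      then show ?thesis using * ij by blast
    next
      case False
      then have "disp S j (disp S i x) = 0" using *[of j i x] ij by auto
      moreover have "disp S i (disp S j x) = disp S j (disp S i x)"
        by (rule disp_comm(1)[OF B]) (use ij in auto)
      ultimately show ?thesis by simp
    qed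
  qed
qed

section \<open>Representations of small dimension\<close>

primrec chain :: "(nat \<Rightarrow> 'a \<Rightarrow> 'a) \<Rightarrow> 'a \<Rightarrow> nat \<Rightarrow> 'a" where
  "chain S v 0 = v"
| "chain S v (Suc i) = disp S (i + 2) (chain S v i)"

lemma chain_in:
  assumes "invariant m S V" "v \<in> disp S 1 ` V" "i + 1 < m"
  shows "chain S v i \<in> disp S (i + 1) ` V" "chain S v i \<in> V"
proof -
  have "chain S v i \<in> disp S (i + 1) ` V \<and> chain S v i \<in> V"
    using assms(3)
  proof (induction i)
    case 0
    then show ?case using assms(2) disp_in[OF assms(1), of 1] by auto
  next
    case (Suc i)
    then have "disp S (i + 2) (chain S v i) \<in> V" by (intro disp_in[OF assms(1)]) auto
    with Suc show ?case by auto
  qed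
  then show "chain S v i \<in> disp S (i + 1) ` V" "chain S v i \<in> V" by auto
qed

text \<open>Chains are numbered from 0: the vector \<open>v_i = chain S v i\<close> lies in the
  image of \<open>A_(i+1)\<close>, so \<open>far_zero\<close> applies to all indices neither equal
  nor adjacent to \<open>i + 1\<close>.\<close>

lemma chain_far:
  assumes "invariant m S V" "far_zero m S V" "v \<in> disp S 1 ` V" "i + 1 < m"
    and "1 \<le> j" "j < m" "i + 3 \<le> j \<or> j + 1 \<le> i"
  shows "disp S j (chain S v i) = 0"
proof -
  obtain w where "w \<in> V" "chain S v i = disp S (i + 1) w"
    using chain_in(1)[OF assms(1,3,4)] by blast
  then show ?thesis using far_zeroD[OF assms(2,5,6), of "i + 1" w] assms(4,7) by auto
qed

text \<open>With \<open>v_i = A_(i+1) w\<close>, the equation \<open>tri S (i + 1) w = 0\<close>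
  reads \<open>A_(i+1) v_(i+1) + A_(i+1) v_i + v_i = 0\<close>.\<close>

lemma chain_down:
  assumes "invariant m S V" "\<And>i x. 1 \<le> i \<Longrightarrow> Suc i < m \<Longrightarrow> x \<in> V \<Longrightarrow> tri S i x = 0"
    and "v \<in> disp S 1 ` V" "i + 2 < m"
  shows "disp S (i + 1) (chain S v (i + 1)) = - S (i + 1) (chain S v i)"
proof -
  obtain w where w: "w \<in> V" "chain S v i = disp S (i + 1) w"
    using chain_in(1)[OF assms(1,3), of i] assms(4) by auto
  have "tri S (i + 1) w = 0" by (rule assms(2)) (use assms(4) w in auto)
  then have "disp S (i + 1) (disp S (i + 2) (chain S v i)) + disp S (i + 1) (chain S v i) + chain S v i = 0"
    unfolding tri_def w(2) by simp
  then have "disp S (i + 1) (disp S (i + 2) (chain S v i)) + S (i + 1) (chain S v i) = 0"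
    by (simp add: disp_def[of S "Suc i" "chain S v i"])
  then show ?thesis by (simp add: eq_neg_iff_add_eq_0)
qed

lemma invariant_image_right:
  assumes "braid_ops m S" "invariant m S V" "3 \<le> m"
  shows "invariant (m - 2) (\<lambda>i. S (i + 2)) (disp S 1 ` V)"
proof (rule invariant_image)
  show "invariant (m - 2) (\<lambda>i. S (i + 2)) V" by (rule invariant_shift[OF assms(2)]) (use assms(3) in simp)
  show "lin (disp S 1)" by (intro lin_disp braid_lin[OF assms(1)]) (use assms(3) in auto)
  show "S (i + 2) (disp S 1 x) = disp S 1 (S (i + 2) x)" if "1 \<le> i" "i < m - 2" for i x
    by (rule disp_comm(2)[OF assms(1)]) (use that in auto)
qed

lemma invariant_image_left:
  assumes "braid_ops m S" "invariant m S V" "3 \<le> m"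
  shows "invariant (m - 2) S (disp S (m - 1) ` V)"
proof (rule invariant_image)
  show "invariant (m - 2) S V" by (rule invariant_mono[OF assms(2)]) simp
  show "lin (disp S (m - 1))" by (intro lin_disp braid_lin[OF assms(1)]) (use assms(3) in auto)
  show "S i (disp S (m - 1) x) = disp S (m - 1) (S i x)" if "1 \<le> i" "i < m - 2" for i x
    by (rule disp_comm(2)[OF assms(1)]) (use that in auto)
qed

lemma dim_le_disp_image:
  assumes "braid_ops m S" "invariant m S V" "dim_le V d" "dim_le (disp S 1 ` V) k" "1 \<le> i" "i < m"
  shows "dim_le (disp S i ` V) k"
  using dim_le_image_conj[OF assms(1-3), of 1 k i] assms(4-6) by (simp add: disp_def[abs_def])

lemma coincide_of_common_image:
  assumes "braid_ops m S" "5 \<le> m" "invariant m S V" "invariant m S W" "coincide m S W"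
    and "\<And>i. 1 \<le> i \<Longrightarrow> i < m \<Longrightarrow> disp S i ` V \<subseteq> W"
  shows "coincide m S V"
proof (rule coincide_extend[OF assms(1-5)])
  fix i j x assume *: "1 \<le> i" "i < m" "1 \<le> j" "j < m" "x \<in> V"
  have "S i x - S j x = disp S i x - disp S j x" by (simp add: disp_def)
  moreover have "disp S i x \<in> W" "disp S j x \<in> W" using assms(6) * by auto
  ultimately show "S i x - S j x \<in> W" using invariant_subspace_of[OF assms(4)] by (simp add: subspace_diff)
qed

lemma line_subset_eq:
  assumes "dim_le U 1" "X \<subseteq> U" "subspace X" "\<not> X \<subseteq> {0}"
  shows "U \<subseteq> X"
proof
  fix y assume y: "y \<in> U"
  obtain x where x: "x \<in> X" "x \<noteq> 0" using assms(4) by blast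
  then obtain c where "y = c *s x" using dim_le_1_multiple[OF assms(1) _ _ y] assms(2) by blast
  then show "y \<in> X" using x assms(3) by (simp add: subspace_scale)
qed

text \<open>One form of \<open>tri\<close> has \<open>A_i\<close> as its leftmost factor throughout,
  and the form in \<open>tri_alt\<close> has \<open>A_(i+1)\<close>.\<close>

lemma tri_in_images:
  assumes "braid_ops m S" "invariant m S V" "1 \<le> i" "Suc i < m" "x \<in> V"
  shows "tri S i x \<in> disp S i ` V" "tri S i x \<in> disp S (Suc i) ` V"
proof -
  have l: "lin (disp S i)" "lin (disp S (Suc i))"
    by (intro lin_disp braid_lin[OF assms(1)]; use assms in simp)+
  have v: "disp S i y \<in> V" "disp S (Suc i) y \<in> V" if "y \<in> V" for y
    using disp_in[OF assms(2) _ _ that] assms(3,4) by auto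
  have V: "y + z \<in> V" if "y \<in> V" "z \<in> V" for y z
    using that invariant_subspace_of[OF assms(2)] by (simp add: subspace_add)
  have "tri S i x = disp S i (disp S (Suc i) (disp S i x) + disp S i x + x)"
    by (simp add: tri_def lin_add[OF l(1)])
  moreover have "disp S (Suc i) (disp S i x) + disp S i x + x \<in> V" by (intro v V assms(5))
  ultimately show "tri S i x \<in> disp S i ` V" by (rule image_eqI)
  have "tri S i x = disp S (Suc i) (disp S i (disp S (Suc i) x) + disp S (Suc i) x + x)"
    unfolding tri_alt[OF assms(1,3,4)] by (simp add: lin_add[OF l(2)])
  moreover have "disp S i (disp S (Suc i) x) + disp S (Suc i) x + x \<in> V" by (intro v V assms(5))
  ultimately show "tri S i x \<in> disp S (Suc i) ` V" by (rule image_eqI)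
qed

lemma disp_image_Suc:
  assumes B: "braid_ops m S" and V: "invariant m S V" "dim_le V d"
    and eq: "disp S 1 ` V = disp S 2 ` V" and "1 \<le> i" "Suc i < m"
  shows "disp S i ` V = disp S (Suc i) ` V"
  using assms(5,6)
proof (induction i rule: nat_induct_at_least)
  case base
  then show ?case using eq by (simp add: numeral_2_eq_2)
next
  case (Suc i)
  have "i + 2 < m" using Suc by simp
  then obtain g where g: "lin g" "\<And>x. S (i + 1) (g x) = g (S i x)" "\<And>x. S (i + 2) (g x) = g (S (i + 1) x)"
    "g ` V = V"
    using tri_conj[OF B Suc(1)] V by metis
  have d: "disp S (i + 1) (g x) = g (disp S i x)" "disp S (i + 2) (g x) = g (disp S (i + 1) x)" for x
    by (simp_all only: disp_def g(2,3) lin_diff[OF g(1)])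
  have "disp S (i + 1) ` g ` V = g ` disp S i ` V" "disp S (i + 2) ` g ` V = g ` disp S (i + 1) ` V"
    unfolding image_image d by (rule HOL.refl)+
  moreover have "g ` disp S i ` V = g ` disp S (i + 1) ` V"
    using Suc by (intro arg_cong[of _ _ "image g"]) simp
  ultimately have "disp S (i + 1) ` V = disp S (i + 2) ` V" unfolding g(4) by metis
  then show ?case by simp
qed

text \<open>In the generic case the vectors of the chain behave like the basis of the reduced Burau
  representation, whose Gram matrix is tridiagonal with nonzero off-diagonal entries.\<close>

lemma coincide_of_rank_one:
  assumes B: "braid_ops m S" "5 \<le> m" and V: "invariant m S V" "dim_le V (m - 3)"
    and r: "dim_le (disp S 1 ` V) 1"
  shows "coincide m S V"
proof -
  note sV = invariant_subspace_of[OF V(1)]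
  have r: "dim_le (disp S i ` V) 1" if "1 \<le> i" "i < m" for i
    using dim_le_disp_image[OF B(1) V r that] .
  have l: "lin (disp S i)" if "1 \<le> i" "i < m" for i
    using that by (intro lin_disp braid_lin[OF B(1)])
  have c1: "coincide (m - 2) (\<lambda>i. S (i + 2)) (disp S 1 ` V)"
    by (rule coincide_line[OF braid_ops_shift[OF B(1)] invariant_image_right[OF B(1) V(1)]])
      (use r[of 1] B(2) in auto)
  have c2: "coincide (m - 2) S (disp S (m - 1) ` V)"
    by (rule coincide_line[OF braid_ops_mono[OF B(1)] invariant_image_left[OF B(1) V(1)]])
      (use r[of "m - 1"] B(2) in auto)
  define X where "X = (\<lambda>x. disp S 3 (disp S 1 x)) ` V"
  note X = far_commute_invariant[OF B V(1) c1 c2 X_def]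
  show ?thesis
  proof (cases "X \<subseteq> {0}")
    \<comment> \<open>A nonzero \<open>X\<close> lies in every line \<open>A_i V\<close> and so
      equals each of them.\<close>
    case False
    show ?thesis
    proof (rule coincide_of_common_image[OF B V(1) X(1)])
      show "disp S i ` V \<subseteq> X" if "1 \<le> i" "i < m" for i
        using line_subset_eq[OF r[OF that] X(2)[OF that] invariant_subspace_of[OF X(1)] False] .
      have "dim_le X 1" using dim_le_subset[OF r[of 1] X(2)[of 1]] B(2) by simp
      then show "coincide m S X" by (rule coincide_line[OF B(1) X(1)])
    qed
  next
    case True
    have far: "far_zero m S V"
      by (rule far_zeroI[OF B(1) V]) (use X(3) True in blast)
    show ?thesis
    proof (cases "\<exists>x\<in>V. tri S 1 x \<noteq> 0")
      case True
      \<comment> \<open>The nonzero vector \<open>tri S 1 x\<close> lies in both lines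
        \<open>A_1 V\<close> and \<open>A_2 V\<close>, which are therefore equal. By conjugation all
        the \<open>A_i V\<close> are one invariant line.\<close>
      then obtain x where x: "x \<in> V" "tri S 1 x \<noteq> 0" by blast
      have t: "tri S 1 x \<in> disp S 1 ` V" "tri S 1 x \<in> disp S 2 ` V"
        using tri_in_images[OF B(1) V(1) _ _ x(1), of 1] B(2) by (simp_all add: numeral_2_eq_2)
      let ?L = "span {tri S 1 x}"
      have "subspace (disp S 1 ` V)" "subspace (disp S 2 ` V)"
        by (intro subspace_lin_image l sV; use B(2) in simp)+
      then have L: "?L \<subseteq> disp S 1 ` V" "?L \<subseteq> disp S 2 ` V"
        using t by (simp_all add: span_minimal)
      have nz: "\<not> ?L \<subseteq> {0}" using x(2) span_base[of "tri S 1 x"] by blast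
      have "disp S 1 ` V \<subseteq> ?L"
        by (rule line_subset_eq[OF _ L(1) subspace_span nz]) (rule r, use B(2) in auto)
      moreover have "disp S 2 ` V \<subseteq> ?L"
        by (rule line_subset_eq[OF _ L(2) subspace_span nz]) (rule r, use B(2) in auto)
      ultimately have eq: "disp S 1 ` V = disp S 2 ` V" using L by (metis subset_antisym)
      have U0: "disp S (Suc i) ` V = disp S 1 ` V" if "Suc i < m" for i
        using that
      proof (induction i)
        case (Suc i)
        have "disp S (Suc i) ` V = disp S (Suc (Suc i)) ` V"
          by (rule disp_image_Suc[OF B(1) V eq]) (use Suc in auto)
        with Suc show ?case by (metis Suc_lessD)
      qed simp
      have U: "disp S i ` V = disp S 1 ` V" if "1 \<le> i" "i < m" for i
        using U0[of "i - 1"] that by simp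
      have W: "invariant m S (disp S 1 ` V)"
        unfolding invariant_def
      proof (intro conjI allI impI)
        show s: "subspace (disp S 1 ` V)" using l[of 1] B(2) sV by (simp add: subspace_lin_image)
        fix i y assume *: "1 \<le> i \<and> i < m \<and> y \<in> disp S 1 ` V"
        then have "y \<in> V" using disp_in[OF V(1), of 1] B(2) by auto
        then have "disp S i y \<in> disp S 1 ` V" using U[of i] * by blast
        then have "disp S i y + y \<in> disp S 1 ` V" using * by (intro subspace_add[OF s]) auto
        then show "S i y \<in> disp S 1 ` V" by (simp add: disp_def[of S i])
      qed
      show ?thesis
      proof (rule coincide_of_common_image[OF B V(1) W])
        show "coincide m S (disp S 1 ` V)" by (rule coincide_line[OF B(1) W]) (use r B(2) in simp)
        show "disp S i ` V \<subseteq> disp S 1 ` V" if "1 \<le> i" "i < m" for i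
          using U[OF that] by (rule equalityD1)
      qed
    next
      case False
      have tri: "tri S i x = 0" if "1 \<le> i" "Suc i < m" "x \<in> V" for i x
        by (rule tri_zero_propagate[OF B(1) V _ that]) (use False in auto)
      show ?thesis
      proof (cases "disp S 1 ` V \<subseteq> {0}")
        case True
        then have "dim_le (disp S i ` V) 0" if "1 \<le> i" "i < m" for i
          using dim_le_disp_image[OF B(1) V _ that, of 0] by (simp only: dim_le_0)
        then have "disp S i x = 0" if "1 \<le> i" "i < m" "x \<in> V" for i x
          using that unfolding dim_le_0 by blast
        then have "S i x = x" if "1 \<le> i" "i < m" "x \<in> V" for i x
          using that by (simp add: disp_def)
        then show ?thesis unfolding coincide_def by metis
      next
        case False
        then obtain v where v: "v \<in> disp S 1 ` V" "v \<noteq> 0" by blast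
        \<comment> \<open>If \<open>v_(i+1)\<close> were zero, so would be
          \<open>A_(i+1) v_(i+1) = - S_(i+1) v_i\<close>, against the injectivity of
          \<open>S_(i+1)\<close>.\<close>
        have nz: "chain S v i \<noteq> 0" if "i + 1 < m" for i
          using that
        proof (induction i)
          case (Suc i)
          then have i: "inj (S (i + 1))" "lin (S (i + 1))"
            by (auto intro!: braid_inj[OF B(1)] braid_lin[OF B(1)])
          have "chain S v i \<noteq> 0" using Suc by simp
          then have "S (i + 1) (chain S v i) \<noteq> S (i + 1) 0" using inj_eq[OF i(1)] by blast
          then have "S (i + 1) (chain S v i) \<noteq> 0" by (simp only: lin_0[OF i(2)] not_False_eq_True)
          moreover have "disp S (i + 1) (chain S v (i + 1)) = - S (i + 1) (chain S v i)"
            by (rule chain_down[OF V(1) tri v(1)]) (use Suc in auto)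
          moreover have "disp S (i + 1) 0 = 0" by (rule lin_0[OF l]) (use Suc in auto)
          ultimately show ?case by (metis Suc_eq_plus1 neg_equal_0_iff_equal)
        qed (use v in simp)
        \<comment> \<open>Dimension at most \<open>m - 3\<close> makes some \<open>v_N\<close>
          depend on the earlier chain vectors. All of these are killed by \<open>A_(N+2)\<close>,
          hence \<open>v_(N+1) = A_(N+2) v_N = 0\<close>; as \<open>N + 2 < m\<close>, this
          contradicts \<open>nz\<close>.\<close>
        obtain N where N: "N \<le> m - 3" "chain S v N \<in> span (chain S v ` {..<N})"
          using dim_le_sequence[OF V(2), of "chain S v"] chain_in(2)[OF V(1) v(1)] B(2) by force
        have Nm: "1 \<le> N + 2" "N + 2 < m" using N(1) B(2) by auto
        have "chain S v ` {..<N} \<subseteq> {y. disp S (N + 2) y = 0}"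
          using chain_far[OF V(1) far v(1) _ Nm] Nm by auto
        moreover have "subspace {y. disp S (N + 2) y = 0}"
          using l[OF Nm] by (intro subspaceI) (simp_all add: lin_simps)
        ultimately have "disp S (N + 2) (chain S v N) = 0"
          using N(2) span_minimal by blast
        then show ?thesis using nz[of "Suc N"] Nm by simp
      qed
    qed
  qed
qed

section \<open>Rescaling, and quotients by a line\<close>

lemma scaled_disp:
  assumes "c \<noteq> 0" "dim_le ((\<lambda>x. S i x - c *s x) ` V) k"
  shows "dim_le (disp (\<lambda>i x. inverse c *s S i x) i ` V) k"
proof -
  have "disp (\<lambda>i x. inverse c *s S i x) i ` V = (\<lambda>x. inverse c *s x) ` (\<lambda>x. S i x - c *s x) ` V"
    unfolding image_image disp_def using assms(1) by (simp add: scale_right_diff_distrib)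
  moreover have "lin (\<lambda>x. inverse c *s x)"
    by (rule linI) (simp_all add: scale_right_distrib scale_left_commute)
  ultimately show ?thesis using dim_le_image assms(2) by simp
qed

lemma invariant_scale:
  assumes "c \<noteq> 0"
  shows "invariant m (\<lambda>i x. c *s S i x) W \<longleftrightarrow> invariant m S W"
proof -
  have "S i x \<in> W" if "subspace W" "c *s S i x \<in> W" for i x
    using subspace_scale[OF that, of "inverse c"] assms by simp
  then show ?thesis unfolding invariant_def using subspace_scale by blast
qed

lemma coincide_scale: "c \<noteq> 0 \<Longrightarrow> coincide m (\<lambda>i x. c *s S i x) W \<longleftrightarrow> coincide m S W"
  unfolding coincide_def by simp

lemma invariant_span:
  assumes "\<And>i. 1 \<le> i \<Longrightarrow> i < m \<Longrightarrow> lin (S i)" "\<And>i b. 1 \<le> i \<Longrightarrow> i < m \<Longrightarrow> b \<in> B \<Longrightarrow> S i b \<in> span B"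
  shows "invariant m S (span B)"
proof -
  have "S i ` span B \<subseteq> span B" if "1 \<le> i" "i < m" for i
    using assms(2)[OF that] unfolding lin_span_image[OF assms(1)[OF that], symmetric]
    by (intro span_minimal) auto
  then show ?thesis unfolding invariant_def by blast
qed

text \<open>The operator \<open>p\<close> removes the coordinate along \<open>v\<close> in a basis
  of the whole space that contains \<open>v\<close>.\<close>

lemma line_projection:
  assumes "v \<noteq> 0"
  obtains p where "lin p" "\<And>x. p x = 0 \<longleftrightarrow> x \<in> span {v}" "\<And>x. x - p x \<in> span {v}"
proof -
  have v: "independent {v}" using assms by simp
  define B where "B = extend_basis {v}"
  have B: "independent B" "span B = UNIV" "v \<in> B"
    using independent_extend_basis[OF v] span_extend_basis[OF v] extend_basis_superset[OF v]
    by (auto simp: B_def)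
  define p where "p x = x - representation B x v *s v" for x
  have r: "representation B (x + y) v = representation B x v + representation B y v"
    "representation B (c *s x) v = c * representation B x v" for x y c
    using B by (simp_all add: representation_add representation_scale)
  have "p v = 0" using B by (simp add: p_def representation_basis)
  moreover have p: "lin p"
    by (rule linI) (simp_all add: p_def r scale_left_distrib scale_right_diff_distrib)
  ultimately have 0: "p x = 0" if "x \<in> span {v}" for x
    using that by (auto simp: span_singleton lin_scale)
  have s: "x - p x \<in> span {v}" for x by (auto simp: p_def span_singleton)
  have "p x = 0 \<longleftrightarrow> x \<in> span {v}" for x using 0[of x] s[of x] by auto
  then show ?thesis by (rule that[OF p _ s])
qed

text \<open>The quotient by a common eigenvector is realised inside the same space: it is the image of
  the projection \<open>p\<close> along the eigenvector, on which \<open>p \<circ> S i\<close> acts.\<close>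

lemma quotient_by_line:
  assumes B: "braid_ops m S" "5 \<le> m" and V: "invariant m S V" "dim_le V d"
    and v: "v \<in> V" "v \<noteq> 0" "\<And>i. 1 \<le> i \<Longrightarrow> i < m \<Longrightarrow> S i v \<in> span {v}"
  obtains Q U where "braid_ops m Q" "invariant m Q U" "dim_le U (d - 1)"
    "coincide m Q U \<Longrightarrow> coincide m S V"
proof -
  obtain p where p: "lin p" "\<And>x. p x = 0 \<longleftrightarrow> x \<in> span {v}" "\<And>x. x - p x \<in> span {v}"
    using line_projection[OF v(2)] by metis
  note l = braid_lin[OF B(1)] and sV = invariant_subspace_of[OF V(1)]
  \<comment> \<open>The summand \<open>x - p x\<close> makes \<open>Q i\<close> the identity on the
    line, so that it is injective on the whole space as \<open>braid_ops\<close> demands.\<close>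
  define Q where "Q i x = p (S i x) + (x - p x)" for i x
  have pp: "p (p x) = p x" for x
    using p(2)[of "x - p x"] p(3)[of x] by (simp add: lin_diff[OF p(1)])
  have Sv: "S i x \<in> span {v}" if "1 \<le> i" "i < m" "x \<in> span {v}" for i x
    using that v(3)[OF that(1,2)] by (auto simp: span_singleton[of v] lin_scale[OF l] intro: span_scale)
  have pSp: "p (S i (p x)) = p (S i x)" if "1 \<le> i" "i < m" for i x
  proof -
    have "p (S i (x - p x)) = 0" using Sv[OF that p(3)] p(2) by blast
    then show ?thesis by (simp add: lin_diff[OF l[OF that]] lin_diff[OF p(1)])
  qed
  have pQ: "p (Q i x) = p (S i x)" for i x
    by (simp add: Q_def lin_simps[OF p(1)] pp)
  have QQ: "Q i (Q j x) = p (S i (S j x)) + (x - p x)" if "1 \<le> i" "i < m" for i j x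
  proof -
    have "p (S i (Q j x)) = p (S i (S j x))" using pSp[OF that, of "Q j x"] pSp[OF that, of "S j x"] pQ by simp
    then show ?thesis unfolding Q_def[of i] pQ by (simp add: Q_def[of j])
  qed
  have QQQ: "Q i (Q j (Q k x)) = p (S i (S j (S k x))) + (x - p x)"
    if "1 \<le> i" "i < m" "1 \<le> j" "j < m" for i j k x
  proof -
    have "p (S i (S j (Q k x))) = p (S i (p (S j (Q k x))))" using pSp[OF that(1,2)] by simp
    also have "p (S j (Q k x)) = p (S j (S k x))"
      using pSp[OF that(3,4), of "Q k x"] pSp[OF that(3,4), of "S k x"] pQ by simp
    also have "p (S i (p (S j (S k x)))) = p (S i (S j (S k x)))" using pSp[OF that(1,2)] by simp
    finally show ?thesis unfolding QQ[OF that(1,2)] pQ by (simp add: Q_def)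
  qed
  have "braid_ops m Q"
    unfolding braid_ops_def
  proof (intro conjI allI impI; (elim conjE)?)
    fix i assume i: "1 \<le> i" "i < m"
    show Qi: "lin (Q i)"
      by (rule linI) (simp_all add: Q_def lin_simps[OF p(1)] lin_simps[OF l[OF i]] scale_right_distrib
          scale_right_diff_distrib)
    show "inj (Q i)"
    proof (rule injI)
      fix x y assume "Q i x = Q i y"
      then have "Q i (x - y) = 0" by (simp add: lin_diff[OF Qi])
      moreover define z where "z = x - y"
      ultimately have 0: "Q i z = 0" by simp
      \<comment> \<open>If \<open>Q i z = 0\<close>, then \<open>z = p z\<close> while
        \<open>S_i z\<close> is on the line. As \<open>S_i\<close> maps the line onto itself,
        \<open>z\<close> is on the line too, so \<open>z = p z = 0\<close>.\<close>
      have pS: "p (S i z) = 0" using arg_cong[OF 0, of p] by (simp only: pQ lin_0[OF p(1)])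
      have zp: "z = p z" using 0 unfolding Q_def pS by simp
      have Sz: "S i z \<in> span {v}" using pS p(2) by blast
      have "S i ` span {v} = span {v}"
        by (rule inj_image_eq[OF l[OF i] braid_inj[OF B(1) i] dim_le_span subspace_span])
          (use Sv[OF i] in auto)
      then obtain w where "w \<in> span {v}" "S i w = S i z" using Sz by force
      then have "z \<in> span {v}" using braid_inj[OF B(1) i] by (metis inj_eq)
      then have "p z = 0" using p(2) by blast
      then show "x = y" using zp by (simp add: z_def)
    qed
  next
    fix i j x assume "1 \<le> i" "i + 2 \<le> j" "j < m"
    then show "Q i (Q j x) = Q j (Q i x)" using braid_far[OF B(1), of i j x] by (simp add: QQ)
  next
    fix i x assume i: "1 \<le> i" "Suc i < m"
    have "Q i (Q (Suc i) (Q i x)) = p (S i (S (Suc i) (S i x))) + (x - p x)"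
      by (rule QQQ) (use i in auto)
    moreover have "Q (Suc i) (Q i (Q (Suc i) x)) = p (S (Suc i) (S i (S (Suc i) x))) + (x - p x)"
      by (rule QQQ) (use i in auto)
    ultimately show "Q i (Q (Suc i) (Q i x)) = Q (Suc i) (Q i (Q (Suc i) x))"
      using braid_adj[OF B(1) i, of x] by simp
  qed
  moreover have Qp: "Q i (p x) = p (S i x)" if "1 \<le> i" "i < m" for i x
    by (simp add: Q_def pp pSp[OF that])
  have "invariant m Q (p ` V)"
    unfolding invariant_def
  proof (intro conjI allI impI)
    show "subspace (p ` V)" using p(1) sV by (rule subspace_lin_image)
    fix i x assume "1 \<le> i \<and> i < m \<and> x \<in> p ` V"
    then show "Q i x \<in> p ` V" using Qp invariantD[OF V(1)] by auto
  qed
  moreover have "\<not> dim_le {x\<in>V. p x = 0} 0"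
    unfolding dim_le_0 using v(1,2) p(2)[of v] span_base[of v "{v}"] by auto
  from dim_le_image_kernel(1)[OF p(1) V(2) sV this] have "dim_le (p ` V) (d - 1)" by simp
  moreover have "coincide m S V" if Q: "coincide m Q (p ` V)"
  proof (rule coincide_extend[OF B V(1)])
    show W: "invariant m S (span {v})" using l v(3) by (intro invariant_span) auto
    show "coincide m S (span {v})" by (rule coincide_line[OF B(1) W]) (simp add: dim_le_span)
    fix i j x assume ij: "1 \<le> i" "i < m" "1 \<le> j" "j < m" "x \<in> V"
    have "Q i (p x) = Q j (p x)" by (rule coincideD[OF Q ij(1-4)]) (use ij(5) in blast)
    then have "p (S i x) = p (S j x)" using Qp[OF ij(1,2)] Qp[OF ij(3,4)] by simp
    then show "S i x - S j x \<in> span {v}" using p(2)[of "S i x - S j x"] by (simp add: lin_diff[OF p(1)])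
  qed
  ultimately show ?thesis using that by blast
qed

text \<open>An eigenvector \<open>v\<close> of \<open>S_1\<close> spans its eigenspace, which
  \<open>S_3\<close>, \<open>S_4\<close>, \<open>S_5\<close> preserve. So \<open>v\<close> is an
  eigenvector of \<open>S_4\<close>, whose eigenspaces also have dimension at most 1, and
  \<open>S_2\<close> commutes with \<open>S_4\<close>. The line of \<open>v\<close> is thus
  invariant, and the quotient has dimension at most 2.\<close>

lemma small_dim_six:
  assumes B: "braid_ops 6 S" and V: "invariant 6 S V" "dim_le V 3"
    and K: "\<And>c. dim_le {x\<in>V. S 1 x = c *s x} 1"
    and five: "\<And>S V. braid_ops 5 S \<Longrightarrow> invariant 5 S V \<Longrightarrow> dim_le V 2 \<Longrightarrow> coincide 5 S V"
  shows "coincide 6 S V"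
proof (cases "V \<subseteq> {0}")
  case True
  then show ?thesis by (rule coincide_trivial[OF B])
next
  case False
  note l = braid_lin[OF B] and sV = invariant_subspace_of[OF V(1)]
  have inV: "S i x \<in> V" if "1 \<le> i" "i < 6" "x \<in> V" for i x using invariantD[OF V(1) that] .
  obtain a v where v: "v \<in> V" "v \<noteq> 0" "S 1 v = a *s v"
    using exists_eigenvector[OF l[of 1] V(2) sV _ False] inV[of 1] by auto
  have line: "S j v \<in> span {v}"
    if "1 \<le> i" "i < 6" "S i v = c *s v" "i + 2 \<le> j \<or> j + 2 \<le> i" "1 \<le> j" "j < 6" for i j c
  proof -
    have "S i (S j v) = c *s S j v"
      using braid_far[OF B that(4,1,2,5,6), of v] that(3) by (simp add: lin_scale[OF l[OF that(5,6)]])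
    moreover have "dim_le {x\<in>V. S i x = c *s x} 1"
      using dim_le_eigenspace_conj[OF B V K that(1,2)] .
    moreover have "v \<in> {x\<in>V. S i x = c *s x}" using v(1) that(3) by simp
    ultimately have "\<exists>b. S j v = b *s v"
      using v inV[OF that(5,6) v(1)] by (intro dim_le_1_multiple[of "{x\<in>V. S i x = c *s x}"]) auto
    then show ?thesis by (auto simp: span_singleton)
  qed
  have 1: "S j v \<in> span {v}" if "j = 3 \<or> j = 4 \<or> j = 5" for j
    by (rule line[of 1 a]) (use v that in auto)
  then obtain b where "S 4 v = b *s v" by (auto simp: span_singleton)
  then have 2: "S 2 v \<in> span {v}" using line[of 4 b 2] by simp
  have Sv: "S i v \<in> span {v}" if "1 \<le> i" "i < 6" for i
  proof -
    have "i = 1 \<or> i = 2 \<or> i = 3 \<or> i = 4 \<or> i = 5" using that by auto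
    then show ?thesis using 1 2 v(3) by (auto simp: span_singleton)
  qed
  obtain Q U where Q: "braid_ops 6 Q" "invariant 6 Q U" "dim_le U (3 - 1)"
    and QS: "coincide 6 Q U \<Longrightarrow> coincide 6 S V"
    using quotient_by_line[OF B _ V v(1,2) Sv] by auto
  \<comment> \<open>The hypothesis \<open>five\<close> is used for the generators
    \<open>1..4\<close> and again for \<open>2..5\<close>; the two ranges overlap, so all five
    agree.\<close>
  have Q1: "coincide 5 Q U"
    using five[OF braid_ops_mono[OF Q(1)] invariant_mono[OF Q(2)]] Q(3) by simp
  have Q2: "coincide 5 (\<lambda>i. Q (i + 1)) U"
    using five[OF braid_ops_shift[OF Q(1), of 5 1] invariant_shift[OF Q(2), of 5 1]] Q(3) by simp
  have "coincide 6 Q U"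
  proof (rule coincideI)
    fix i x assume i: "1 \<le> i" "Suc i < 6" "x \<in> U"
    show "Q i x = Q (Suc i) x"
    proof (cases "Suc i < 5")
      case True
      show ?thesis by (rule coincideD[OF Q1]) (use i True in auto)
    next
      case False
      have "Q (i - 1 + 1) x = Q (i + 1) x" by (rule coincideD[OF Q2]) (use i False in auto)
      then show ?thesis using i by simp
    qed
  qed
  then show ?thesis by (rule QS)
qed

lemma eigenvalue_nonzero:
  assumes "lin f" "inj f" "\<not> dim_le {x\<in>V. f x = c *s x} k"
  shows "c \<noteq> 0"
proof
  assume "c = 0"
  have "x = 0" if "f x = c *s x" for x
    using injD[OF assms(2), of x 0] lin_0[OF assms(1)] that \<open>c = 0\<close> by simp
  then have "{x\<in>V. f x = c *s x} \<subseteq> {0}" by blast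
  then have "dim_le {x\<in>V. f x = c *s x} 0" by (simp add: dim_le_0)
  then show False using assms(3) dim_le_mono by blast
qed

text \<open>If an eigenspace of \<open>S_1\<close> has dimension at least \<open>m - 4\<close>, then
  \<open>S_1 - c\<close> has rank at most 1. Otherwise the eigenspaces have dimension at most
  \<open>m - 5 = (m - 2) - 3\<close>, and by induction the generators
  \<open>S_3, ..., S_(m-1)\<close> of a braid group on \<open>m - 2\<close> strings agree on each of
  them.\<close>

theorem small_dim_coincide:
  assumes "braid_ops m S" "5 \<le> m" "invariant m S V" "dim_le V (m - 3)"
  shows "coincide m S V"
  using assms
proof (induction m arbitrary: S V rule: less_induct)
  case (less m)
  note B = less.prems(1,2) and V = less.prems(3,4)
  note l = braid_lin[OF B(1)] and sV = invariant_subspace_of[OF V(1)]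
  have l1: "lin (S 1)" and i1: "inj (S 1)" using l[of 1] braid_inj[OF B(1), of 1] B(2) by auto
  show ?case
  proof (cases "\<exists>c. \<not> dim_le {x\<in>V. S 1 x = c *s x} (m - 5)")
    case True
    then obtain c where c: "\<not> dim_le {x\<in>V. S 1 x = c *s x} (m - 5)" by blast
    have c0: "c \<noteq> 0" using eigenvalue_nonzero[OF l1 i1 c] .
    have "\<not> dim_le {x\<in>V. S 1 x - c *s x = 0} (m - 5)" using c by simp
    from dim_le_image_kernel(1)[OF lin_shift[OF l1] V(2) sV this]
    have "dim_le ((\<lambda>x. S 1 x - c *s x) ` V) (m - 3 - Suc (m - 5))" .
    moreover have "m - 3 - Suc (m - 5) = 1" using B(2) by simp
    ultimately have "dim_le (disp (\<lambda>i x. inverse c *s S i x) 1 ` V) 1"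
      using scaled_disp[OF c0, where S = S and i = 1] by simp
    then have "coincide m (\<lambda>i x. inverse c *s S i x) V"
      using c0 V invariant_scale[of "inverse c"]
      by (intro coincide_of_rank_one[OF braid_ops_scale[OF B(1)] B(2)]) auto
    then show ?thesis using coincide_scale[of "inverse c"] c0 by simp
  next
    case False
    then have K: "dim_le {x\<in>V. S 1 x = c *s x} (m - 5)" for c by blast
    consider "m = 5" | "m = 6" | "7 \<le> m" using B(2) by linarith
    then show ?thesis
    proof cases
      case 1
      \<comment> \<open>Now \<open>m - 5 = 0\<close>, so \<open>S_1\<close> has no eigenvector in
        \<open>V\<close>.\<close>
      have "V \<subseteq> {0}"
      proof (rule ccontr)
        assume "\<not> V \<subseteq> {0}"
        moreover have "S 1 ` V \<subseteq> V" using invariantD[OF V(1), of 1] B(2) by auto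
        ultimately obtain c v where "v \<in> V" "v \<noteq> 0" "S 1 v = c *s v"
          using exists_eigenvector[OF l1 V(2) sV] by blast
        then show False using K[of c] 1 by (auto simp: dim_le_0)
      qed
      then show ?thesis by (rule coincide_trivial[OF B(1)])
    next
      \<comment> \<open>Here \<open>m - 2 = 4\<close> is too small for the general step; the
        induction hypothesis is used for 5 strings in dimension 2 instead.\<close>
      case 2
      have five: "coincide 5 S' V'" if "braid_ops 5 S'" "invariant 5 S' V'" "dim_le V' 2" for S' V'
        using less.IH[OF _ that(1) _ that(2)] that(3) 2 by simp
      have "coincide 6 S V"
        by (rule small_dim_six[OF _ _ _ _ five]) (use B V K 2 in simp_all)
      then show ?thesis using 2 by simp
    next
      case 3
      have Sh: "braid_ops (m - 2) (\<lambda>i. S (i + 2))" "invariant (m - 2) (\<lambda>i. S (i + 2)) V"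
        using braid_ops_shift[OF B(1), of "m - 2" 2] invariant_shift[OF V(1), of "m - 2" 2] B(2)
        by auto
      have comm: "S (i + 2) (S 1 x) = S 1 (S (i + 2) x)" if "1 \<le> i" "i < m - 2" for i x
        by (rule braid_far[OF B(1)]) (use that in auto)
      have "coincide (m - 2) (\<lambda>i. S (i + 2)) V"
      proof (rule coincide_of_eigenspaces[OF Sh(1) _ l1 comm V(2) Sh(2)])
        show "5 \<le> m - 2" using 3 by simp
        show "S 1 ` V \<subseteq> V" using invariantD[OF V(1), of 1] B(2) by auto
        fix c
        have "invariant (m - 2) (\<lambda>i. S (i + 2)) {x\<in>V. S 1 x = c *s x}"
          by (rule invariant_eigenspace[OF Sh(2) braid_lin[OF Sh(1)] l1 comm])
        then show "coincide (m - 2) (\<lambda>i. S (i + 2)) {x\<in>V. S 1 x = c *s x}"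
          using 3 K[of c] by (intro less.IH[OF _ Sh(1)]) auto
      qed
      then show ?thesis by (rule coincide_of_shift[OF B V(1)])
    qed
  qed
qed

section \<open>Invariant subspaces of small dimension\<close>

text \<open>By \<open>chain_down\<close> and induction \<open>A_(i+1) v_(i+1) = - c v_i\<close>.
  Inserting this into the second form of \<open>tri S (i + 1) v_i = 0\<close> gives
  \<open>- c v_(i+1) + S_(i+2) v_(i+1) = 0\<close>.\<close>

lemma chain_eigen:
  assumes V: "invariant m S V" and "braid_ops m S"
    and tri: "\<And>i x. 1 \<le> i \<Longrightarrow> Suc i < m \<Longrightarrow> x \<in> V \<Longrightarrow> tri S i x = 0"
    and v: "v \<in> disp S 1 ` V" "S 1 v = c *s v"
    and "i + 1 < m"
  shows "S (i + 1) (chain S v i) = c *s chain S v i"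
  using assms(6)
proof (induction i)
  case 0
  then show ?case using v by simp
next
  case (Suc i)
  let ?w = "chain S v i" and ?w' = "chain S v (i + 1)"
  have w: "?w \<in> V" using chain_in(2)[OF V v(1)] Suc by simp
  have l: "lin (disp S (i + 2))" by (intro lin_disp braid_lin[OF assms(2)]) (use Suc in auto)
  have "disp S (i + 1) ?w' = - S (i + 1) ?w"
    by (rule chain_down[OF V tri v(1)]) (use Suc in auto)
  also have "S (i + 1) ?w = c *s ?w" using Suc by simp
  finally have d: "disp S (i + 1) ?w' = - (c *s ?w)" .
  have w': "disp S (i + 2) ?w = ?w'" by simp
  have "tri S (i + 1) ?w = 0" by (rule tri) (use Suc w in auto)
  moreover have "tri S (i + 1) ?w = disp S (i + 2) (disp S (i + 1) (disp S (i + 2) ?w)) +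
      disp S (i + 2) (disp S (i + 2) ?w) + disp S (i + 2) ?w"
    using tri_alt[OF assms(2), of "i + 1" ?w] Suc by simp
  ultimately have "disp S (i + 2) (- (c *s ?w)) + disp S (i + 2) ?w' + ?w' = 0"
    unfolding w' d by simp
  then have "- (c *s ?w') + disp S (i + 2) ?w' + ?w' = 0"
    by (simp only: lin_neg[OF l] lin_scale[OF l] w')
  moreover have "disp S (i + 2) ?w' + ?w' = S (i + 2) ?w'"
    by (simp only: disp_def diff_add_cancel)
  ultimately have "S (i + 2) ?w' = c *s ?w'"
    by (metis add.assoc minus_unique minus_minus)
  then show ?case by simp
qed

text \<open>The matrices are tridiagonal: \<open>A_j v_i\<close> is \<open>v_(i+1)\<close> for
  \<open>j = i + 2\<close>, a multiple of \<open>v_i\<close> for \<open>j = i + 1\<close>, a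
  multiple of \<open>v_(i-1)\<close> for \<open>j = i\<close>, and zero otherwise.\<close>

lemma chain_invariant:
  assumes V: "invariant m S V" and B: "braid_ops m S" and far: "far_zero m S V"
    and tri: "\<And>i x. 1 \<le> i \<Longrightarrow> Suc i < m \<Longrightarrow> x \<in> V \<Longrightarrow> tri S i x = 0"
    and v: "v \<in> disp S 1 ` V" "S 1 v = c *s v"
  shows "invariant m S (span (chain S v ` {..<m - 1}))"
proof (rule invariant_span[OF braid_lin[OF B]])
  let ?B = "chain S v ` {..<m - 1}"
  fix j b assume j: "1 \<le> j" "j < m" and "b \<in> ?B"
  then obtain i where "i < m - 1" "b = chain S v i" by blast
  then have i: "i + 1 < m" "b = chain S v i" by auto
  have base: "chain S v k \<in> span ?B" if "k + 1 < m" for k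
    using that by (intro span_base) auto
  have S: "S j b = disp S j b + b" by (simp add: disp_def)
  consider "i + 3 \<le> j \<or> j + 1 \<le> i" | "j = i + 2" | "j = i + 1" | "j = i"
    by linarith
  then show "S j b \<in> span ?B"
  proof cases
    case 1
    then have "disp S j b = 0" unfolding i(2) by (intro chain_far[OF V far v(1) i(1) j])
    then show ?thesis using base[OF i(1)] i(2) S by simp
  next
    case 2
    then have "S j b = chain S v (i + 1) + chain S v i" using S i(2) by simp
    then show ?thesis using base[of "i + 1"] base[OF i(1)] 2 j by (simp add: span_add)
  next
    case 3
    then show ?thesis
      using chain_eigen[OF V B tri v i(1)] base[OF i(1)] i(2) by (simp add: span_scale)
  next
    case 4
    define k where "k = i - 1"
    have k: "i = k + 1" using 4 j by (simp add: k_def)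
    have "disp S (k + 1) (chain S v (k + 1)) = - S (k + 1) (chain S v k)"
      by (rule chain_down[OF V tri v(1)]) (use i k in auto)
    also have "S (k + 1) (chain S v k) = c *s chain S v k"
      by (rule chain_eigen[OF V B tri v]) (use i k in auto)
    finally have "disp S j b = - (c *s chain S v k)" using 4 i(2) k by simp
    moreover have "chain S v k \<in> span ?B" using base i k by simp
    ultimately show ?thesis using S base[OF i(1)] i(2) by (simp add: span_diff span_scale)
  qed
qed

section \<open>Reversing the order of the generators, and the images of \<open>tri\<close>\<close>

lemma braid_ops_mirror:
  assumes "braid_ops m S"
  shows "braid_ops m (\<lambda>i. S (m - i))"
  unfolding braid_ops_def
proof (intro conjI allI impI; (elim conjE)?)
  fix i assume "1 \<le> i" "i < m"
  then show "lin (S (m - i))" "inj (S (m - i))"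
    by (auto intro!: braid_lin[OF assms] braid_inj[OF assms])
next
  fix i j x assume "1 \<le> i" "i + 2 \<le> j" "j < m"
  then show "S (m - i) (S (m - j) x) = S (m - j) (S (m - i) x)"
    by (intro braid_far[OF assms]) auto
next
  fix i x assume i: "1 \<le> i" "Suc i < m"
  then have "m - i = Suc (m - Suc i)" by simp
  then show "S (m - i) (S (m - Suc i) (S (m - i) x)) = S (m - Suc i) (S (m - i) (S (m - Suc i) x))"
    using braid_adj[OF assms, of "m - Suc i" x] i by simp
qed

text \<open>Reversal exchanges the roles of \<open>i\<close> and \<open>i + 1\<close>, under which
  \<open>tri\<close> is symmetric by \<open>tri_alt\<close>.\<close>

lemma tri_mirror:
  assumes "braid_ops m S" "1 \<le> i" "Suc i < m"
  shows "tri (\<lambda>i. S (m - i)) (m - Suc i) x = tri S i x"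
proof -
  have "m - (m - Suc i) = Suc i" "m - Suc (m - Suc i) = i" using assms(3) by auto
  then show ?thesis unfolding tri_alt[OF assms] by (simp add: tri_def disp_def)
qed

lemma far_zero_mirror: "far_zero m S V \<Longrightarrow> far_zero m (\<lambda>i. S (m - i)) V"
  unfolding far_zero_def
proof (intro allI impI)
  fix i j
  assume *: "\<forall>i j. 1 \<le> i \<and> i < m \<and> 1 \<le> j \<and> j < m \<and> (i + 2 \<le> j \<or> j + 2 \<le> i) \<longrightarrow>
      (\<forall>x\<in>V. disp S i (disp S j x) = 0)"
    and ij: "1 \<le> i \<and> i < m \<and> 1 \<le> j \<and> j < m \<and> (i + 2 \<le> j \<or> j + 2 \<le> i)"
  have "1 \<le> m - i \<and> m - i < m \<and> 1 \<le> m - j \<and> m - j < m \<and> (m - i + 2 \<le> m - j \<or> m - j + 2 \<le> m - i)"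
    using ij by auto
  then have "\<forall>x\<in>V. disp S (m - i) (disp S (m - j) x) = 0" using * by blast
  then show "\<forall>x\<in>V. disp (\<lambda>i. S (m - i)) i (disp (\<lambda>i. S (m - i)) j x) = 0"
    by (simp add: disp_def)
qed

lemma invariant_mirror: "invariant m S V \<Longrightarrow> invariant m (\<lambda>i. S (m - i)) V"
proof -
  assume V: "invariant m S V"
  have "S (m - i) x \<in> V" if "1 \<le> i" "i < m" "x \<in> V" for i x
    by (rule invariantD[OF V]) (use that in auto)
  then show ?thesis using invariant_subspace_of[OF V] by (simp add: invariant_def)
qed

text \<open>The vector \<open>y\<close> lies in the images of both \<open>A_i\<close> and
  \<open>A_(i+1)\<close>, and any other index is far from one of these two, so
  \<open>A_j y = 0\<close>.\<close>

lemma tri_fixed: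
  assumes "braid_ops m S" "invariant m S V" "far_zero m S V"
    and "1 \<le> i" "Suc i < m" "y \<in> tri S i ` V" "1 \<le> j" "j < m" "j \<noteq> i" "j \<noteq> Suc i"
  shows "S j y = y"
proof -
  obtain x where x: "x \<in> V" "y = tri S i x" using assms(6) by blast
  obtain w w' where w: "w \<in> V" "y = disp S i w" "w' \<in> V" "y = disp S (Suc i) w'"
    using tri_in_images[OF assms(1,2,4,5) x(1)] x(2) by blast
  have "i + 2 \<le> j \<or> j + 2 \<le> i \<or> Suc i + 2 \<le> j \<or> j + 2 \<le> Suc i" using assms(9,10) by auto
  then have "disp S j y = 0"
    using far_zeroD[OF assms(3,7,8), of i w] far_zeroD[OF assms(3,7,8), of "Suc i" w'] w assms(4,5)
    by (metis Suc_lessD le_SucI)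
  then show ?thesis by (simp add: disp_def)
qed

text \<open>On \<open>y\<close> the conjugating operator \<open>g = S_i S_(i+1) S_(i+2)\<close>
  reduces to \<open>S_(i+1)\<close>: since \<open>S_(i+2)\<close> fixes \<open>y\<close>,
  \<open>g y = S_i S_(i+1) y\<close>, and since \<open>S_i\<close> fixes \<open>g y\<close>,
  cancelling \<open>S_i\<close> gives \<open>g y = S_(i+1) y\<close>. Both claims then follow from
  the conjugation rules for \<open>g\<close>.\<close>

lemma tri_move:
  assumes B: "braid_ops m S" and V: "invariant m S V" "dim_le V d" and far: "far_zero m S V"
    and i: "1 \<le> i" "i + 2 < m" and y: "y \<in> tri S i ` V"
  shows "S (i + 1) y \<in> tri S (i + 1) ` V"
    and "S (i + 1) (S (i + 1) y) = t *s y \<Longrightarrow>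
      S (i + 2) (S (i + 2) (S (i + 1) y)) = t *s S (i + 1) y"
proof -
  obtain g where g: "lin g" "inj g" "\<And>x. g x = S i (S (i + 1) (S (i + 2) x))"
    "\<And>x. S (i + 2) (g x) = g (S (i + 1) x)" "\<And>x. tri S (i + 1) (g x) = g (tri S i x)" "g ` V = V"
    using tri_conj[OF B i] V by metis
  have "S (i + 2) y = y" by (rule tri_fixed[OF B V(1) far i(1) _ y]) (use i in auto)
  then have gy: "g y = S i (S (i + 1) y)" by (simp only: g(3))
  obtain x where "x \<in> V" "y = tri S i x" using y by blast
  then have "g y = tri S (i + 1) (g x)" "g x \<in> V" using g(5,6) by auto
  then have gin: "g y \<in> tri S (i + 1) ` V" by blast
  have "S i (g y) = g y" by (rule tri_fixed[OF B V(1) far _ _ gin i(1)]) (use i in auto)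
  then have "S i (g y) = S i (S (i + 1) y)" using gy by simp
  moreover have "inj (S i)" by (rule braid_inj[OF B]) (use i in auto)
  ultimately have eq: "S (i + 1) y = g y" using injD by metis
  then show "S (i + 1) y \<in> tri S (i + 1) ` V" using gin by (simp only:)
  show "S (i + 2) (S (i + 2) (S (i + 1) y)) = t *s S (i + 1) y" if "S (i + 1) (S (i + 1) y) = t *s y"
    unfolding eq g(4) by (simp only: eq[symmetric] that lin_scale[OF g(1)])
qed

text \<open>This is \<open>tri_move\<close> for the reversed system, where index
  \<open>i + 1\<close> of \<open>tri\<close> becomes \<open>m - (i + 2)\<close>.\<close>

lemma tri_move_back:
  assumes B: "braid_ops m S" and V: "invariant m S V" "dim_le V d" and far: "far_zero m S V"
    and i: "1 \<le> i" "i + 2 < m" and y: "y \<in> tri S (i + 1) ` V"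
  shows "S (i + 1) y \<in> tri S i ` V"
proof -
  let ?M = "\<lambda>i. S (m - i)"
  define k where "k = m - (i + 2)"
  have k: "1 \<le> k" "k + 2 < m" "m - (k + 1) = i + 1" using i by (auto simp: k_def)
  have "tri ?M k x = tri S (i + 1) x" for x
    using tri_mirror[OF B, of "i + 1" x] i by (simp add: k_def)
  then have "y \<in> tri ?M k ` V" using y by simp
  then have "?M (k + 1) y \<in> tri ?M (k + 1) ` V"
    by (rule tri_move(1)[OF braid_ops_mirror[OF B] invariant_mirror[OF V(1)] V(2) far_zero_mirror[OF far] k(1,2)])
  moreover have "tri ?M (k + 1) ` V = tri S i ` V"
  proof (rule image_cong[OF HOL.refl])
    have "k + 1 = m - Suc i" using i by (simp add: k_def)
    then show "tri ?M (k + 1) x = tri S i x" for x using tri_mirror[OF B i(1), of x] i by simp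
  qed
  ultimately show ?thesis unfolding k(3) by (simp only:)
qed

section \<open>Ladders and the invariant subspaces they span\<close>

primrec ladder :: "(nat \<Rightarrow> 'a \<Rightarrow> 'a) \<Rightarrow> 'a \<Rightarrow> nat \<Rightarrow> 'a" where
  "ladder S y 0 = y"
| "ladder S y (Suc k) = S (k + 2) (ladder S y k)"

text \<open>Write \<open>h_k = ladder S y k\<close>. In the list
  \<open>S_1 y, h_0, ..., h_(m-2)\<close> of \<open>m\<close> vectors, each \<open>S_j\<close>
  interchanges the entries in positions \<open>j\<close> and \<open>j + 1\<close>, with a factor
  \<open>t\<close> in one direction, and fixes all the others.\<close>

lemma ladder_invariant:
  assumes B: "braid_ops m S" "4 \<le> m" and V: "invariant m S V" "dim_le V d" and far: "far_zero m S V"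
    and y: "y \<in> tri S 1 ` V" "S 2 (S 2 y) = t *s y" "t \<noteq> 0"
  shows "invariant m S (span (insert (S 1 y) (ladder S y ` {..m - 2})))"
proof (rule invariant_span[OF braid_lin[OF B(1)]])
  let ?h = "ladder S y" and ?B = "insert (S 1 y) (ladder S y ` {..m - 2})"
  note l = braid_lin[OF B(1)] and farc = braid_far[OF B(1)] and adj = braid_adj[OF B(1)]
  have h: "?h k \<in> tri S (k + 1) ` V" "S (k + 2) (S (k + 2) (?h k)) = t *s ?h k" if "k + 2 < m" for k
  proof -
    have "?h k \<in> tri S (k + 1) ` V \<and> S (k + 2) (S (k + 2) (?h k)) = t *s ?h k"
      using that
    proof (induction k)
      case 0
      then show ?case using y by (simp add: eval_nat_numeral)
    next
      case (Suc k)
      then show ?case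
        using tri_move(1)[OF B(1) V far, of "k + 1" "?h k"] tri_move(2)[OF B(1) V far, of "k + 1" "?h k" t]
        by simp
    qed
    then show "?h k \<in> tri S (k + 1) ` V" "S (k + 2) (S (k + 2) (?h k)) = t *s ?h k" by auto
  qed
  have fixed: "S j (?h k) = ?h k" if "k + 2 < m" "1 \<le> j" "j < m" "j \<noteq> k + 1" "j \<noteq> k + 2" for j k
    by (rule tri_fixed[OF B(1) V(1) far _ _ h(1)[OF that(1)]]) (use that in auto)
  have hB: "?h k \<in> span ?B" if "k \<le> m - 2" for k using that by (intro span_base) auto
  have S1B: "S 1 y \<in> span ?B" by (intro span_base) simp
  \<comment> \<open>As \<open>h_1\<close> is in the image of \<open>tri S 2\<close>, it is fixed by
    \<open>S_1\<close>; this requires \<open>4 \<le> m\<close>.\<close>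
  have h1: "?h 1 = S 2 y" "S 2 (?h 1) = t *s y" "S 1 (?h 1) = ?h 1"
    using y(2) fixed[of 1 1] B(2) by (simp_all add: numeral_2_eq_2)
  have a: "S 1 (S 2 (S 1 x)) = S 2 (S 1 (S 2 x))" for x
    using adj[of 1 x] B(2) by (simp add: numeral_2_eq_2)
  have l12: "lin (S 1)" "lin (S 2)" using l[of 1] l[of 2] B(2) by auto
  \<comment> \<open>Multiplied by \<open>t\<close>, the vector \<open>y\<close> becomes
    \<open>S_2 h_1\<close>; the braid relation and \<open>S_1 h_1 = h_1\<close> then do the rest,
    here and in \<open>S21\<close>.\<close>
  have S11: "S 1 (S 1 y) = t *s y"
  proof -
    have "t *s S 1 (S 1 y) = S 1 (S 1 (S 2 (S 1 (?h 1))))"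
      unfolding h1(3) h1(2) by (simp only: lin_scale[OF l12(1)])
    also have "\<dots> = S 1 (S 2 (S 1 (t *s y)))" unfolding a h1(2) ..
    also have "\<dots> = t *s S 2 (S 1 (S 2 y))" by (simp only: lin_scale[OF l12(1)] lin_scale[OF l12(2)] a)
    also have "S 2 (S 1 (S 2 y)) = t *s y" unfolding h1(1)[symmetric] h1(3) h1(2) ..
    finally show ?thesis using scale_left_imp_eq[OF y(3)] by blast
  qed
  have S21: "S 2 (S 1 y) = S 1 y"
  proof -
    have "t *s S 2 (S 1 y) = S 2 (S 1 (S 2 (?h 1)))"
      unfolding h1(2) by (simp only: lin_scale[OF l12(1)] lin_scale[OF l12(2)])
    also have "\<dots> = S 1 (S 2 (S 1 (?h 1)))" by (rule a[symmetric])
    also have "\<dots> = t *s S 1 y" unfolding h1(3) h1(2) by (simp only: lin_scale[OF l12(1)])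
    finally show ?thesis using y(3) by simp
  qed
  fix j b assume j: "1 \<le> j" "j < m" and b: "b \<in> ?B"
  consider "b = S 1 y" | k where "k + 2 < m" "b = ?h k" | "b = ?h (m - 2)"
  proof -
    have "b = S 1 y \<or> (\<exists>k. k + 2 < m \<and> b = ?h k) \<or> b = ?h (m - 2)"
    proof (cases "b = S 1 y")
      case False
      then have "b \<in> ?h ` {..m - 2}" using b by simp
      then obtain k where "b = ?h k" "k \<in> {..m - 2}" by (rule imageE)
      then have "k + 2 < m \<or> k = m - 2" by auto
      then show ?thesis using \<open>b = ?h k\<close> by blast
    qed simp
    then show ?thesis using that by blast
  qed
  then show "S j b \<in> span ?B"
  proof cases
    case 1
    consider "j = 1" | "j = 2" | "3 \<le> j" using j by linarith
    then show ?thesis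
    proof cases
      case 1
      then have "S j b = t *s ?h 0" using S11 \<open>b = S 1 y\<close> by simp
      then show ?thesis using hB[of 0] by (simp only: span_scale)
    next
      case 2
      then show ?thesis using S21 S1B \<open>b = S 1 y\<close> by simp
    next
      case 3
      have "S j b = S 1 (S j y)" unfolding \<open>b = S 1 y\<close> by (rule farc) (use 3 j B(2) in auto)
      also have "S j y = y" using fixed[of 0 j] 3 j B(2) by simp
      finally show ?thesis using S1B by simp
    qed
  next
    case 2
    consider "j = k + 2" | "j = k + 1" "k = 0" | "j = k + 1" "k \<noteq> 0" | "j \<noteq> k + 1" "j \<noteq> k + 2"
      by blast
    then show ?thesis
    proof cases
      case 1
      then have "S j b = ?h (Suc k)" using 2(2) by simp
      then show ?thesis using hB[of "Suc k"] 2(1) by simp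
    next
      case a: 2
      then show ?thesis using S1B 2 by simp
    next
      case 3
      define i where "i = k - 1"
      have "k = Suc i" using 3 by (simp add: i_def)
      then have "S j b = t *s ?h i" using h(2)[of i] 2 3 by simp
      then show ?thesis using hB[of i] 2(1) \<open>k = Suc i\<close> by (simp add: span_scale)
    next
      case 4
      then show ?thesis using fixed[OF 2(1) j] hB[of k] 2 by simp
    qed
  next
    case 3
    \<comment> \<open>The last vector \<open>h_(m-2)\<close> is outside the range of
      \<open>h\<close> and \<open>fixed\<close>, so it is treated through its two predecessors
      \<open>h_(i+1)\<close> and \<open>h_i\<close>.\<close>
    define i where "i = m - 4"
    have m: "m - 2 = Suc (Suc i)" "i + 4 = m" using B(2) by (simp_all add: i_def)
    let ?p = "?h (i + 1)"
    have b: "b = S (i + 3) ?p" using 3 m(1) by (simp add: eval_nat_numeral)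
    have hp: "?p = S (i + 2) (?h i)" by simp
    consider "j = i + 3" | "j = i + 2" | "j \<le> i + 1" using j m(2) by linarith
    then show ?thesis
    proof cases
      case 1
      then have "S j b = t *s ?p" using h(2)[of "i + 1"] b m(2) by (simp add: eval_nat_numeral)
      moreover have "?p \<in> span ?B" by (rule hB) (use m(1) in simp)
      ultimately show ?thesis by (simp only: span_scale)
    next
      case 2
      have "S (i + 2) (S (i + 3) (S (i + 2) (?h i))) = S (i + 3) (S (i + 2) (S (i + 3) (?h i)))"
        using adj[of "i + 2" "?h i"] m(2) by (simp add: eval_nat_numeral)
      also have "S (i + 3) (?h i) = ?h i" by (rule fixed) (use m in auto)
      finally have "S j b = b" using 2 b hp by simp
      then show ?thesis using hB[of "m - 2"] 3 by simp
    next
      case a: 3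
      have "S j b = S (i + 3) (S j ?p)" unfolding b by (rule farc) (use a j m in auto)
      also have "S j ?p = ?p" by (rule fixed) (use a j m in auto)
      finally show ?thesis using hB[of "m - 2"] b 3 by simp
    qed
  qed
qed

section \<open>Existence of a nonzero invariant subspace of dimension at most
  \<open>m\<close>\<close>

lemma exists_small_invariant_tri:
  assumes B: "braid_ops m S" "4 \<le> m" and V: "invariant m S V" "dim_le V d" and far: "far_zero m S V"
    and x: "x \<in> V" "tri S 1 x \<noteq> 0"
  shows "\<exists>W. invariant m S W \<and> W \<subseteq> V \<and> \<not> W \<subseteq> {0} \<and> dim_le W m"
proof -
  note sV = invariant_subspace_of[OF V(1)]
  have l: "lin (S 1)" "lin (S 2)" "inj (S 2)" using braid_lin[OF B(1)] braid_inj[OF B(1)] B(2) by auto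
  have lt: "lin (tri S 1)" using l by (intro lin_tri) (simp_all add: numeral_2_eq_2)
  let ?X = "tri S 1 ` V"
  have XV: "?X \<subseteq> V" using tri_in[OF V(1), of 1] B(2) by auto
  \<comment> \<open>\<open>S_2\<close> maps the image of \<open>tri S 1\<close> into that of
    \<open>tri S 2\<close> and back again, so its square has an eigenvector there.\<close>
  have "S 2 (S 2 y) \<in> ?X" if "y \<in> ?X" for y
  proof -
    have "S 2 y \<in> tri S 2 ` V" using tri_move(1)[OF B(1) V far, of 1 y] that B(2) by (simp add: numeral_2_eq_2)
    then show ?thesis using tri_move_back[OF B(1) V far, of 1 "S 2 y"] B(2) by (simp add: numeral_2_eq_2)
  qed
  then have inv: "(\<lambda>y. S 2 (S 2 y)) ` ?X \<subseteq> ?X" by blast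
  have "\<not> ?X \<subseteq> {0}" using x by blast
  moreover have "lin (\<lambda>y. S 2 (S 2 y))" using l(2) by (intro linI) (simp_all add: lin_simps)
  ultimately obtain t y where y: "y \<in> ?X" "y \<noteq> 0" "S 2 (S 2 y) = t *s y"
    using exists_eigenvector[OF _ dim_le_subset[OF V(2) XV] subspace_lin_image[OF lt sV] inv] by blast
  have t: "t \<noteq> 0"
  proof
    assume "t = 0"
    then have "S 2 (S 2 y) = S 2 (S 2 0)" using y(3) by (simp add: lin_0[OF l(2)])
    then show False using y(2) injD[OF l(3)] by blast
  qed
  let ?B = "insert (S 1 y) (ladder S y ` {..m - 2})"
  have W: "invariant m S (span ?B)" by (rule ladder_invariant[OF B V far y(1,3) t])
  have yV: "y \<in> V" using XV y(1) by blast
  have "ladder S y k \<in> V" if "k \<le> m - 2" for k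
    using that
  proof (induction k)
    case (Suc k)
    have "S (k + 2) (ladder S y k) \<in> V" by (rule invariantD[OF V(1)]) (use Suc in auto)
    then show ?case by simp
  qed (use yV in simp)
  moreover have "S 1 y \<in> V" using invariantD[OF V(1) _ _ yV] B(2) by simp
  ultimately have "?B \<subseteq> V" by auto
  then have "span ?B \<subseteq> V" using sV by (rule span_minimal)
  moreover have "\<not> span ?B \<subseteq> {0}"
  proof -
    have "y \<in> ?B" by (rule insertI2, rule image_eqI[of _ _ 0]) auto
    then have "y \<in> span ?B" by (rule span_base)
    then show ?thesis using y(2) by blast
  qed
  moreover have "dim_le (span ?B) m"
  proof (rule dim_le_span)
    have "card ?B \<le> Suc (card (ladder S y ` {..m - 2}))" by (simp add: card_insert_if)
    also have "\<dots> \<le> Suc (card {..m - 2})" using card_image_le[of "{..m - 2}"] by simp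
    finally show "card ?B \<le> m" using B(2) by simp
  qed simp
  ultimately show ?thesis using W by blast
qed

lemma exists_small_invariant_coincide:
  assumes B: "braid_ops m S" "2 \<le> m" and V: "invariant m S V" "dim_le V d" "\<not> V \<subseteq> {0}"
    and c: "coincide m S V"
  shows "\<exists>W. invariant m S W \<and> W \<subseteq> V \<and> \<not> W \<subseteq> {0} \<and> dim_le W m"
proof -
  note sV = invariant_subspace_of[OF V(1)]
  have "S 1 ` V \<subseteq> V" using invariantD[OF V(1), of 1] B(2) by auto
  then obtain a v where v: "v \<in> V" "v \<noteq> 0" "S 1 v = a *s v"
    using exists_eigenvector[OF braid_lin[OF B(1), of 1] V(2) sV _ V(3)] B(2) by auto
  have "S i v = a *s v" if "1 \<le> i" "i < m" for i
    using coincideD[OF c that _ _ v(1), of 1] v(3) B(2) by simp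
  then have "invariant m S (span {v})"
    by (intro invariant_span braid_lin[OF B(1)]) (auto intro: span_scale span_base)
  moreover have "span {v} \<subseteq> V" using v(1) sV by (intro span_minimal) auto
  moreover have "\<not> span {v} \<subseteq> {0}" using v(2) span_base[of v "{v}"] by blast
  moreover have "dim_le (span {v}) m" using B(2) by (intro dim_le_span) auto
  ultimately show ?thesis by blast
qed

text \<open>The bound \<open>m - 5 = (m - 2) - 3\<close> lets \<open>small_dim_coincide\<close> act
  on the images of \<open>A_1\<close> and \<open>A_(m-1)\<close>, which provides the hypotheses of
  \<open>far_commute_invariant\<close>. Either \<open>X\<close> is the wanted subspace, or distant
  \<open>A_i\<close> annihilate each other and a ladder, a common eigenvector or a chain provides
  it.\<close>

lemma exists_small_invariant_unipotent_part:
  assumes B: "braid_ops m S" "7 \<le> m" and V: "invariant m S V" "dim_le V d" "\<not> V \<subseteq> {0}"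
    and r: "dim_le (disp S 1 ` V) (m - 5)"
  shows "\<exists>W. invariant m S W \<and> W \<subseteq> V \<and> \<not> W \<subseteq> {0} \<and> dim_le W m"
proof -
  note sV = invariant_subspace_of[OF V(1)]
  have c1: "coincide (m - 2) (\<lambda>i. S (i + 2)) (disp S 1 ` V)"
    by (rule small_dim_coincide[OF braid_ops_shift[OF B(1)] _ invariant_image_right[OF B(1) V(1)]])
      (use B(2) r in auto)
  have "dim_le (disp S (m - 1) ` V) (m - 5)"
    by (rule dim_le_disp_image[OF B(1) V(1,2) r]) (use B(2) in auto)
  then have c2: "coincide (m - 2) S (disp S (m - 1) ` V)"
    by (intro small_dim_coincide[OF braid_ops_mono[OF B(1)] _ invariant_image_left[OF B(1) V(1)]])
      (use B(2) in auto)
  define X where "X = (\<lambda>x. disp S 3 (disp S 1 x)) ` V"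
  have m5: "5 \<le> m" using B(2) by simp
  note X = far_commute_invariant[OF B(1) m5 V(1) c1 c2 X_def]
  have dV: "disp S 1 ` V \<subseteq> V" using disp_in[OF V(1), of 1] B(2) by auto
  have X1: "X \<subseteq> disp S 1 ` V" using X(2)[of 1] B(2) by simp
  show ?thesis
  proof (cases "X \<subseteq> {0}")
    case False
    have "dim_le X m" using dim_le_mono[OF dim_le_subset[OF r X1]] by simp
    then show ?thesis using X(1) X1 dV False by blast
  next
    case True
    have far: "far_zero m S V"
      by (rule far_zeroI[OF B(1) V(1,2)]) (use X(3) True in blast)
    show ?thesis
    proof (cases "\<exists>x\<in>V. tri S 1 x \<noteq> 0")
      case True
      then show ?thesis using exists_small_invariant_tri[OF B(1) _ V(1,2) far] B(2) by auto
    next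
      case False
      have tri: "tri S i x = 0" if "1 \<le> i" "Suc i < m" "x \<in> V" for i x
        by (rule tri_zero_propagate[OF B(1) V(1,2) _ that]) (use False in auto)
      show ?thesis
      proof (cases "disp S 1 ` V \<subseteq> {0}")
        case True
        then have "dim_le (disp S i ` V) 0" if "1 \<le> i" "i < m" for i
          using dim_le_disp_image[OF B(1) V(1,2) _ that, of 0] by (simp only: dim_le_0)
        then have "disp S i x = 0" if "1 \<le> i" "i < m" "x \<in> V" for i x
          using that unfolding dim_le_0 by blast
        then have "S i x = x" if "1 \<le> i" "i < m" "x \<in> V" for i x
          using that by (simp add: disp_def)
        then have "coincide m S V" unfolding coincide_def by metis
        then show ?thesis using exists_small_invariant_coincide[OF B(1) _ V] B(2) by simp
      next
        case False
        have l: "lin (S 1)" by (rule braid_lin[OF B(1)]) (use B(2) in auto)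
        have ld: "lin (disp S 1)" using l by (rule lin_disp)
        have "S 1 ` disp S 1 ` V \<subseteq> disp S 1 ` V"
        proof -
          have "S 1 (disp S 1 x) = disp S 1 (S 1 x)" for x by (simp only: disp_def lin_diff[OF l])
          then show ?thesis using invariantD[OF V(1), of 1] B(2) by auto
        qed
        then obtain a v where v: "v \<in> disp S 1 ` V" "v \<noteq> 0" "S 1 v = a *s v"
          using exists_eigenvector[OF l r subspace_lin_image[OF ld sV] _ False] by blast
        let ?B = "chain S v ` {..<m - 1}"
        have "invariant m S (span ?B)" by (rule chain_invariant[OF V(1) B(1) far tri v(1,3)])
        moreover have "span ?B \<subseteq> V"
          using chain_in(2)[OF V(1) v(1)] sV by (intro span_minimal) auto
        moreover have "\<not> span ?B \<subseteq> {0}"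
        proof -
          have "v \<in> ?B" by (rule image_eqI[of _ _ 0]) (use B(2) in auto)
          then have "v \<in> span ?B" by (rule span_base)
          then show ?thesis using v(2) by blast
        qed
        moreover have "dim_le (span ?B) m"
          using card_image_le[of "{..<m - 1}" "chain S v"] by (intro dim_le_span) auto
        ultimately show ?thesis by blast
      qed
    qed
  qed
qed

text \<open>An eigenspace of dimension at least 6 leaves rank at most
  \<open>m + 1 - 6 = m - 5\<close> for \<open>S_1 - c\<close>. If there is none, all eigenspaces
  have dimension at most \<open>5 \<le> (m - 2) - 3\<close>, which is where
  \<open>10 \<le> m\<close> is used; then all generators agree on \<open>V\<close> and have a common
  eigenvector.\<close>

theorem exists_small_invariant:
  assumes B: "braid_ops m S" "10 \<le> m" and V: "invariant m S V" "dim_le V (m + 1)" "\<not> V \<subseteq> {0}"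
  shows "\<exists>W. invariant m S W \<and> W \<subseteq> V \<and> \<not> W \<subseteq> {0} \<and> dim_le W m"
proof (cases "\<exists>c. \<not> dim_le {x\<in>V. S 1 x = c *s x} 5")
  case True
  then obtain c where c: "\<not> dim_le {x\<in>V. S 1 x = c *s x} 5" by blast
  note sV = invariant_subspace_of[OF V(1)]
  have l1: "lin (S 1)" "inj (S 1)" using braid_lin[OF B(1), of 1] braid_inj[OF B(1), of 1] B(2) by auto
  have c0: "c \<noteq> 0" using eigenvalue_nonzero[OF l1 c] .
  let ?S = "\<lambda>i x. inverse c *s S i x"
  have "\<not> dim_le {x\<in>V. S 1 x - c *s x = 0} 5" using c by simp
  from dim_le_image_kernel(1)[OF lin_shift[OF l1(1)] V(2) sV this]
  have "dim_le ((\<lambda>x. S 1 x - c *s x) ` V) (m + 1 - Suc 5)" .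
  then have "dim_le (disp ?S 1 ` V) (m + 1 - Suc 5)" by (rule scaled_disp[OF c0])
  then have "dim_le (disp ?S 1 ` V) (m - 5)" by simp
  moreover have "inverse c \<noteq> 0" using c0 by simp
  ultimately show ?thesis
    using exists_small_invariant_unipotent_part[OF braid_ops_scale[OF B(1)], of "inverse c" V "m + 1"] V B(2)
    by (simp add: invariant_scale)
next
  case False
  then have K: "dim_le {x\<in>V. S 1 x = c *s x} 5" for c by blast
  have Sh: "braid_ops (m - 2) (\<lambda>i. S (i + 2))" "invariant (m - 2) (\<lambda>i. S (i + 2)) V"
    using braid_ops_shift[OF B(1), of "m - 2" 2] invariant_shift[OF V(1), of "m - 2" 2] B(2) by auto
  have l1: "lin (S 1)" using braid_lin[OF B(1), of 1] B(2) by auto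
  have comm: "S (i + 2) (S 1 x) = S 1 (S (i + 2) x)" if "1 \<le> i" "i < m - 2" for i x
    by (rule braid_far[OF B(1)]) (use that in auto)
  have "coincide (m - 2) (\<lambda>i. S (i + 2)) V"
  proof (rule coincide_of_eigenspaces[OF Sh(1) _ l1 comm V(2) Sh(2)])
    show "5 \<le> m - 2" using B(2) by simp
    show "S 1 ` V \<subseteq> V" using invariantD[OF V(1), of 1] B(2) by auto
    fix c
    have "invariant (m - 2) (\<lambda>i. S (i + 2)) {x\<in>V. S 1 x = c *s x}"
      by (rule invariant_eigenspace[OF Sh(2) braid_lin[OF Sh(1)] l1 comm])
    then show "coincide (m - 2) (\<lambda>i. S (i + 2)) {x\<in>V. S 1 x = c *s x}"
      using B(2) dim_le_mono[OF K[of c], of "m - 2 - 3"] by (intro small_dim_coincide[OF Sh(1)]) auto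
  qed
  then have "coincide m S V" using B(2) by (intro coincide_of_shift[OF B(1) _ V(1)]) auto
  then show ?thesis using exists_small_invariant_coincide[OF B(1) _ V] B(2) by simp
qed

end

section \<open>Matrix representations\<close>

text \<open>Complex sequences form a type that serves as one ambient space for all dimensions;
  vectors of a given length are only a carrier set.\<close>

definition fun_scale :: "complex \<Rightarrow> (nat \<Rightarrow> complex) \<Rightarrow> nat \<Rightarrow> complex" where
  "fun_scale c f = (\<lambda>k. c * f k)"

interpretation fun_space: complex_space fun_scale
  by unfold_locales (simp_all add: fun_scale_def fun_eq_iff algebra_simps)

text \<open>A matrix of size \<open>d\<close> acts on the first \<open>d\<close> coordinates of a sequence and fixes the others;
  the vectors of length \<open>d\<close> become the sequences supported on \<open>{..<d}\<close>.\<close>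

definition mat_op :: "nat \<Rightarrow> complex mat \<Rightarrow> (nat \<Rightarrow> complex) \<Rightarrow> nat \<Rightarrow> complex" where
  "mat_op d M f = (\<lambda>k. if k < d then (M *\<^sub>v vec d f) $ k else f k)"

definition supported :: "nat \<Rightarrow> (nat \<Rightarrow> complex) set" where
  "supported d = {f. \<forall>k\<ge>d. f k = 0}"

lemma vec_mat_op: "M \<in> carrier_mat d d \<Longrightarrow> vec d (mat_op d M f) = M *\<^sub>v vec d f"
  by (rule eq_vecI) (simp_all add: mat_op_def)

lemma mat_op_mult:
  assumes "M \<in> carrier_mat d d" "N \<in> carrier_mat d d"
  shows "mat_op d (M * N) f = mat_op d M (mat_op d N f)"
proof -
  have "M * N *\<^sub>v vec d f = M *\<^sub>v vec d (mat_op d N f)"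
    unfolding vec_mat_op[OF assms(2)] using assms by (intro assoc_mult_mat_vec) auto
  then show ?thesis by (simp add: mat_op_def[of d "M * N"] mat_op_def[of d M]) (simp add: mat_op_def fun_eq_iff)
qed

lemma mat_op_one: "mat_op d (1\<^sub>m d) f = f"
  by (simp add: mat_op_def fun_eq_iff)

lemma lin_mat_op:
  assumes "M \<in> carrier_mat d d"
  shows "fun_space.lin (mat_op d M)"
proof (rule fun_space.linI)
  fix f g :: "nat \<Rightarrow> complex" and c
  have "vec d (f + g) = vec d f + vec d g" by (rule eq_vecI) simp_all
  then show "mat_op d M (f + g) = mat_op d M f + mat_op d M g"
    using assms mult_add_distrib_mat_vec[OF assms, of "vec d f" "vec d g"]
    by (auto simp: mat_op_def fun_eq_iff)
  have "vec d (fun_scale c f) = c \<cdot>\<^sub>v vec d f" by (rule eq_vecI) (simp_all add: fun_scale_def)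
  then show "mat_op d M (fun_scale c f) = fun_scale c (mat_op d M f)"
    using assms mult_mat_vec[OF assms, of "vec d f" c]
    by (auto simp: mat_op_def fun_eq_iff fun_scale_def)
qed

lemma mat_op_supported: "f \<in> supported d \<Longrightarrow> mat_op d M f \<in> supported d"
  by (simp add: mat_op_def supported_def)

lemma subspace_supported: "fun_space.subspace (supported d)"
  by (rule fun_space.subspaceI) (simp_all add: supported_def fun_scale_def)

definition unit_fun :: "nat \<Rightarrow> nat \<Rightarrow> complex" where
  "unit_fun i = (\<lambda>k. if k = i then 1 else 0)"

lemma dim_le_supported: "fun_space.dim_le (supported d) d"
proof -
  have "f \<in> fun_space.span (unit_fun ` {..<d})" if "f \<in> supported d" for f
  proof -
    have "f = (\<Sum>i<d. fun_scale (f i) (unit_fun i))"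
    proof
      fix k
      have "(\<Sum>i<d. fun_scale (f i) (unit_fun i)) k = (\<Sum>i<d. fun_scale (f i) (unit_fun i) k)"
        by (induction d) simp_all
      also have "\<dots> = (\<Sum>i<d. if i = k then f k else 0)"
        by (rule sum.cong) (auto simp: fun_scale_def unit_fun_def)
      also have "\<dots> = f k" using that by (auto simp: supported_def)
      finally show "f k = (\<Sum>i<d. fun_scale (f i) (unit_fun i)) k" ..
    qed
    also have "\<dots> \<in> fun_space.span (unit_fun ` {..<d})"
      by (intro fun_space.span_sum fun_space.span_scale fun_space.span_base) auto
    finally show ?thesis .
  qed
  moreover have "card (unit_fun ` {..<d}) \<le> d" using card_image_le[of "{..<d}" unit_fun] by simp
  ultimately show ?thesis unfolding fun_space.dim_le_def by (intro exI[of _ "unit_fun ` {..<d}"]) auto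
qed

text \<open>Some unit sequence would lie in the span of the earlier ones, all of which vanish at its
  index.\<close>

lemma not_dim_le_supported: "\<not> fun_space.dim_le (supported (Suc d)) d"
proof
  assume *: "fun_space.dim_le (supported (Suc d)) d"
  have "unit_fun i \<in> supported (Suc d)" if "i \<le> d" for i
    using that by (auto simp: unit_fun_def supported_def)
  then obtain N where N: "unit_fun N \<in> fun_space.span (unit_fun ` {..<N})"
    using fun_space.dim_le_sequence[OF *, of unit_fun] by blast
  have "fun_space.span (unit_fun ` {..<N}) \<subseteq> {f. f N = 0}"
    by (rule fun_space.span_minimal, (auto simp: unit_fun_def)[1], rule fun_space.subspaceI)
      (auto simp: fun_scale_def)
  then show False using N by (auto simp: unit_fun_def)
qed

section \<open>The general linear group and the action of words\<close>

lemma GL_carrier: "M \<in> carrier (GL d) \<Longrightarrow> M \<in> carrier_mat d d"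
  by (auto simp: GL_def units_of_carrier Units_def ring_mat_simps)

lemma GL_mult: "M \<otimes>\<^bsub>GL d\<^esub> N = M * N"
  by (simp add: GL_def units_of_mult ring_mat_simps)

lemma GL_one: "\<one>\<^bsub>GL d\<^esub> = 1\<^sub>m d"
  by (simp add: GL_def units_of_one ring_mat_simps)

lemma group_GL: "group (GL d)"
proof -
  interpret ring "ring_mat TYPE(complex) d ()" by (rule ring_mat)
  show ?thesis unfolding GL_def by (rule units_group)
qed

lemma pres_class_rel:
  assumes "(u, v) \<in> R" "u \<in> gwords X" "v \<in> gwords X"
  shows "pres_rel X R `` {u} = pres_rel X R `` {v}"
  using assms by (simp add: pres_class_eq_iff pres_eq.rel)

lemma representation_word_closed:
  assumes \<rho>: "\<rho> \<in> hom (presented_group X R) (GL d)"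
    and gen: "\<And>x w. x \<in> X \<Longrightarrow> w \<in> W \<Longrightarrow> \<rho> (pres_gen X R x) *\<^sub>v w \<in> W"
    and inv: "\<And>x w. x \<in> X \<Longrightarrow> w \<in> W \<Longrightarrow> \<rho> (pres_rel X R `` {[(x, False)]}) *\<^sub>v w \<in> W"
    and W: "W \<subseteq> carrier_vec d" and u: "u \<in> gwords X" and w: "w \<in> W"
  shows "\<rho> (pres_rel X R `` {u}) *\<^sub>v w \<in> W"
  using u
proof (induction u rule: list.induct)
  case Nil
  interpret group_hom "presented_group X R" "GL d" \<rho>
    using \<rho> group_presented_group[of X R] group_GL[of d] by (simp add: group_hom_def group_hom_axioms_def)
  have "\<rho> (pres_rel X R `` {[]}) = 1\<^sub>m d" using hom_one by (simp add: presented_group_one GL_one)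
  then show ?case using w W by auto
next
  case (Cons a u)
  obtain x e where a: "a = (x, e)" by (cases a)
  have x: "x \<in> X" and u: "u \<in> gwords X" and xe: "[(x, e)] \<in> gwords X" using Cons.prems a by auto
  let ?c = "\<lambda>u. pres_rel X R `` {u}"
  have "?c (a # u) = ?c [(x, e)] \<otimes>\<^bsub>presented_group X R\<^esub> ?c u"
    using presented_group_mult_class[OF xe u] a by simp
  then have "\<rho> (?c (a # u)) = \<rho> (?c [(x, e)]) * \<rho> (?c u)"
    using hom_mult[OF \<rho> presented_group_class_closed[OF xe] presented_group_class_closed[OF u]]
    by (simp add: GL_mult)
  moreover have "\<rho> (?c [(x, e)]) \<in> carrier_mat d d" "\<rho> (?c u) \<in> carrier_mat d d"
    using hom_in_carrier[OF \<rho> presented_group_class_closed[OF xe]]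
      hom_in_carrier[OF \<rho> presented_group_class_closed[OF u]]
    by (simp_all add: GL_carrier)
  ultimately have "\<rho> (?c (a # u)) *\<^sub>v w = \<rho> (?c [(x, e)]) *\<^sub>v (\<rho> (?c u) *\<^sub>v w)"
    using w W assoc_mult_mat_vec by auto
  then show ?case using Cons.IH[OF u] gen[OF x] inv[OF x] by (cases e) (auto simp: pres_gen_def)
qed

lemma subspace_vec_image:
  assumes W: "fun_space.subspace W" "W \<subseteq> supported d"
  shows "VectorSpace.subspace class_ring (vec d ` W) (module_vec TYPE(complex) d)"
proof -
  have add: "v + w \<in> vec d ` W" if vw: "v \<in> vec d ` W" "w \<in> vec d ` W" for v w
  proof -
    obtain f g where "f \<in> W" "v = vec d f" "g \<in> W" "w = vec d g" using vw by blast
    moreover have "vec d f + vec d g = vec d (f + g)" by (rule eq_vecI) simp_all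
    ultimately show ?thesis using fun_space.subspace_add[OF W(1)] by (intro image_eqI[of _ _ "f + g"]) auto
  qed
  have scale: "c \<cdot>\<^sub>v v \<in> vec d ` W" if v: "v \<in> vec d ` W" for c v
  proof -
    obtain f where "f \<in> W" "v = vec d f" using v by blast
    moreover have "c \<cdot>\<^sub>v vec d f = vec d (fun_scale c f)"
      by (rule eq_vecI) (simp_all add: fun_scale_def)
    ultimately show ?thesis
      using fun_space.subspace_scale[OF W(1)] by (intro image_eqI[of _ _ "fun_scale c f"]) auto
  qed
  have "0\<^sub>v d = vec d (0 :: nat \<Rightarrow> complex)" by (rule eq_vecI) simp_all
  then have zero: "0\<^sub>v d \<in> vec d ` W" using fun_space.subspace_0[OF W(1)] by blast
  have vs: "vectorspace class_ring (module_vec TYPE(complex) d)" by (rule vec_vs)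
  then have "LinearCombinations.submodule class_ring (vec d ` W) (module_vec TYPE(complex) d)"
    unfolding LinearCombinations.submodule_def vectorspace_def
    using add scale zero by (auto simp: module_vec_def)
  with vs show ?thesis by (simp add: VectorSpace.subspace_def)
qed

section \<open>The contradiction to irreducibility\<close>

theorem theorem6p1:
  fixes n :: nat
  assumes "n \<ge> 10"
  shows "\<not> (\<exists>\<rho>. irreducible_representation (braid_group n) (n + 1) \<rho>)"
proof
  assume "\<exists>\<rho>. irreducible_representation (braid_group n) (n + 1) \<rho>"
  then obtain \<rho> where irr: "irreducible_representation (braid_group n) (n + 1) \<rho>" by blast
  define d where "d = n + 1"
  define X where "X = {1..n - 1}"
  define R where "R = braid_relations n"
  let ?G = "presented_group X R" and ?c = "\<lambda>u. pres_rel X R `` {u}"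
  have G: "braid_group n = ?G" by (simp add: braid_group_def X_def R_def)
  have \<rho>: "\<rho> \<in> hom ?G (GL d)"
    using irr by (simp add: irreducible_representation_def complex_representation_def G d_def)
  have simple: "W = {0\<^sub>v d} \<or> W = carrier_vec d" if "invariant_subspace ?G d \<rho> W" for W
    using irr that by (simp add: irreducible_representation_def G d_def)
  have mat: "\<rho> (?c u) \<in> carrier_mat d d" if "u \<in> gwords X" for u
    using hom_in_carrier[OF \<rho> presented_group_class_closed[OF that]] by (rule GL_carrier)
  have mult: "\<rho> (?c (u @ v)) = \<rho> (?c u) * \<rho> (?c v)" if "u \<in> gwords X" "v \<in> gwords X" for u v
    using hom_mult[OF \<rho> presented_group_class_closed[OF that(1)] presented_group_class_closed[OF that(2)]]
    by (simp add: GL_mult presented_group_mult_class[OF that])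
  interpret h: group_hom ?G "GL d" \<rho>
    using \<rho> group_presented_group[of X R] group_GL[of d] by (simp add: group_hom_def group_hom_axioms_def)
  have one: "\<rho> (?c []) = 1\<^sub>m d" using h.hom_one by (simp add: presented_group_one GL_one)
  define P where "P u = mat_op d (\<rho> (?c u))" for u
  have P_append: "P (u @ v) f = P u (P v f)" if "u \<in> gwords X" "v \<in> gwords X" for u v f
    unfolding P_def mult[OF that] by (rule mat_op_mult[OF mat[OF that(1)] mat[OF that(2)]])
  have P_rel: "P u = P v" if "(u, v) \<in> R" "u \<in> gwords X" "v \<in> gwords X" for u v
    unfolding P_def pres_class_rel[OF that] ..
  define S where "S i = P [(i, True)]" for i
  have g: "[(i, e)] \<in> gwords X" if "1 \<le> i" "i < n" for i e using that by (auto simp: X_def)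
  \<comment> \<open>The inverse letter gives a left inverse of \<open>S i\<close>, which proves
    injectivity here and invariance under inverse letters below.\<close>
  have inv: "P [(i, False)] (S i f) = f" if "1 \<le> i" "i < n" for i f
  proof -
    have "i \<in> X" using that by (auto simp: X_def)
    from pres_eq.cancel[OF this, of R False] have "?c [(i, False), (i, True)] = ?c []"
      using g[OF that] by (subst pres_class_eq_iff) auto
    then have "P ([(i, False)] @ [(i, True)]) f = f" by (simp add: P_def one mat_op_one)
    then show ?thesis unfolding S_def P_append[OF g[OF that] g[OF that]] .
  qed
  have lin: "fun_space.lin (S i)" if "1 \<le> i" "i < n" for i
    unfolding S_def P_def by (rule lin_mat_op[OF mat[OF g[OF that]]])
  have B: "fun_space.braid_ops n S"
    unfolding fun_space.braid_ops_def
  proof (intro conjI allI impI; (elim conjE)?)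
    fix i assume i: "1 \<le> i" "i < n"
    show "fun_space.lin (S i)" by (rule lin[OF i])
    show "inj (S i)" using inv[OF i] by (metis injI)
  next
    fix i j f assume ij: "1 \<le> i" "i + 2 \<le> j" "j < n"
    then have g': "[(i, True)] \<in> gwords X" "[(j, True)] \<in> gwords X" by (auto simp: X_def)
    have "([(i, True), (j, True)], [(j, True), (i, True)]) \<in> R"
      unfolding R_def braid_relations_def using ij by (intro UnI1) force
    then have "P ([(i, True)] @ [(j, True)]) f = P ([(j, True)] @ [(i, True)]) f"
      using P_rel g' by auto
    then show "S i (S j f) = S j (S i f)" unfolding S_def P_append[OF g'] P_append[OF g'(2,1)] .
  next
    fix i f assume i: "1 \<le> i" "Suc i < n"
    then have g': "[(i, True)] \<in> gwords X" "[(Suc i, True)] \<in> gwords X" by (auto simp: X_def)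
    have "([(i, True), (Suc i, True), (i, True)], [(Suc i, True), (i, True), (Suc i, True)]) \<in> R"
      unfolding R_def braid_relations_def using i by (intro UnI2) force
    then have "P ([(i, True)] @ ([(Suc i, True)] @ [(i, True)])) f =
        P ([(Suc i, True)] @ ([(i, True)] @ [(Suc i, True)])) f"
      using P_rel g' by auto
    moreover have "P ([(i, True)] @ ([(Suc i, True)] @ [(i, True)])) f = S i (S (Suc i) (S i f))"
      using g' by (subst P_append, simp, simp, subst P_append) (simp_all add: S_def)
    moreover have "P ([(Suc i, True)] @ ([(i, True)] @ [(Suc i, True)])) f = S (Suc i) (S i (S (Suc i) f))"
      using g' by (subst P_append, simp, simp, subst P_append) (simp_all add: S_def)
    ultimately show "S i (S (Suc i) (S i f)) = S (Suc i) (S i (S (Suc i) f))" by simp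
  qed
  have V: "fun_space.invariant n S (supported d)"
    using subspace_supported by (simp add: fun_space.invariant_def S_def P_def mat_op_supported)
  have "\<not> supported d \<subseteq> {0}"
  proof
    assume "supported d \<subseteq> {0}"
    moreover have "unit_fun 0 \<in> supported d" by (auto simp: unit_fun_def supported_def d_def)
    ultimately have "unit_fun 0 0 = 0" by auto
    then show False by (simp add: unit_fun_def)
  qed
  then obtain W where W: "fun_space.invariant n S W" "W \<subseteq> supported d" "\<not> W \<subseteq> {0}" "fun_space.dim_le W n"
    using fun_space.exists_small_invariant[OF B assms V] dim_le_supported[of d] by (auto simp: d_def)
  note sW = fun_space.invariant_subspace_of[OF W(1)]
  have step: "\<rho> (?c u) *\<^sub>v w \<in> vec d ` W"
    if u: "u \<in> gwords X" and PW: "P u ` W \<subseteq> W" and w: "w \<in> vec d ` W" for u w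
  proof -
    obtain f where f: "f \<in> W" "w = vec d f" using w by blast
    have "\<rho> (?c u) *\<^sub>v w = vec d (P u f)" unfolding f(2) P_def vec_mat_op[OF mat[OF u]] ..
    then show ?thesis using PW f(1) by blast
  qed
  have closed: "\<rho> (?c u) *\<^sub>v w \<in> vec d ` W" if "u \<in> gwords X" "w \<in> vec d ` W" for u w
  proof (rule representation_word_closed[OF \<rho> _ _ _ that])
    fix x w assume x: "x \<in> X" and w: "w \<in> vec d ` W"
    then have x': "1 \<le> x" "x < n" by (auto simp: X_def)
    have "P [(x, True)] ` W \<subseteq> W" using fun_space.invariantD[OF W(1) x'] by (auto simp: S_def)
    then show "\<rho> (pres_gen X R x) *\<^sub>v w \<in> vec d ` W"
      unfolding pres_gen_def by (rule step[OF g[OF x'] _ w])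
    \<comment> \<open>On \<open>W\<close>, which has finite dimension, \<open>S x\<close> is onto,
      so the inverse letter maps \<open>W\<close> into itself as well.\<close>
    have SW: "S x ` W = W" by (rule fun_space.braid_image_eq[OF B W(1,4) x'])
    have "P [(x, False)] f \<in> W" if f: "f \<in> W" for f
    proof -
      obtain h where "h \<in> W" "f = S x h" using f SW by blast
      then show ?thesis using inv[OF x', of h] by simp
    qed
    then have "P [(x, False)] ` W \<subseteq> W" by blast
    then show "\<rho> (?c [(x, False)]) *\<^sub>v w \<in> vec d ` W" by (rule step[OF g[OF x'] _ w])
  qed auto
  have "invariant_subspace ?G d \<rho> (vec d ` W)"
    unfolding invariant_subspace_def
  proof (intro conjI ballI)
    show "VectorSpace.subspace class_ring (vec d ` W) (module_vec TYPE(complex) d)"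
      by (rule subspace_vec_image[OF sW W(2)])
    fix A w assume "A \<in> carrier ?G" "w \<in> vec d ` W"
    then show "\<rho> A *\<^sub>v w \<in> vec d ` W" by (elim presented_group_carrier_cases) (simp add: closed)
  qed
  then have alternative: "vec d ` W = {0\<^sub>v d} \<or> vec d ` W = carrier_vec d" by (rule simple)
  have vec_inj: "f = h" if "f \<in> supported d" "h \<in> supported d" "vec d f = vec d h" for f h
  proof (rule ext)
    fix k
    show "f k = h k"
    proof (cases "k < d")
      case True
      then have "f k = vec d f $ k" "h k = vec d h $ k" by simp_all
      then show ?thesis unfolding that(3) by simp
    qed (use that(1,2) in \<open>simp add: supported_def\<close>)
  qed
  have "vec d ` W \<noteq> {0\<^sub>v d}"
  proof
    assume *: "vec d ` W = {0\<^sub>v d}"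
    have "f = 0" if "f \<in> W" for f
    proof (rule vec_inj)
      have "vec d f = 0\<^sub>v d" using * that by blast
      also have "\<dots> = vec d (0 :: nat \<Rightarrow> complex)" by (rule eq_vecI) simp_all
      finally show "vec d f = vec d 0" .
    qed (use W(2) that in \<open>auto simp: supported_def\<close>)
    then show False using W(3) by blast
  qed
  moreover have "vec d ` W \<noteq> carrier_vec d"
  proof
    assume *: "vec d ` W = carrier_vec d"
    have "supported d \<subseteq> W"
    proof
      fix f assume f: "f \<in> supported d"
      have "vec d f \<in> vec d ` W" using * by simp
      then obtain h where "h \<in> W" "vec d f = vec d h" by blast
      then show "f \<in> W" using vec_inj[OF f] W(2) by blast
    qed
    \<comment> \<open>The full space has dimension \<open>d = n + 1\<close>, one more than the bound
      for \<open>W\<close>.\<close>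
    then have "fun_space.dim_le (supported (Suc n)) n"
      using fun_space.dim_le_subset[OF W(4)] by (simp add: d_def)
    then show False using not_dim_le_supported by blast
  qed
  ultimately show False using alternative by simp
qed

end
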